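(* For every dihedral group $D_{2n}$ (of order $2n$), the group algebra $\mathbb{C}[D_{2n}]$ is of Knutson type.
   Context: For a finite group $G$, a virtual $\mathbb{C}[G]$-module is an integer linear combination of simple $\mathbb{C}[G]$-modules (an element of the representation ring). The Knutson Index $\mathcal{K}(M)$ of a $\mathbb{C}[G]$-module $M$ is the smallest integer $m\ge1$ such that $M\otimes N\cong m\,\mathbb{C}[G]$ (equality in the representation ring) for some virtual $\mathbb{C}[G]$-module $N$. The group algebra $\mathbb{C}[G]$ is of Knutson type if $\mathcal{K}(M)=1$ for every simple $\mathbb{C}[G]$-module $M$. *)

theory Defs
  imports
    Jordan_Normal_Form.VS_Connect
    "HOL-Algebra.Free_Abelian_Groups"
    "HOL-Algebra.Generated_Groups"
begin

text \<open>
  A finite-dimensional $\mathbb{C}[G]$-module is given in coordinates: a module structure on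
  $\mathbb{C}^d$ is a function \<open>M\<close> sending each group element to the matrix by which it acts.
  The values of \<open>M\<close> outside \<open>carrier G\<close> are arbitrary; modules that differ only there are
  isomorphic in the sense of \<open>cg_iso\<close> below.
\<close>

type_synonym 'g cg_mod = "'g \<Rightarrow> complex mat"

definition cg_dim :: "('g, 'x) monoid_scheme \<Rightarrow> 'g cg_mod \<Rightarrow> nat" where
  "cg_dim G M = dim_row (M \<one>\<^bsub>G\<^esub>)"

definition cg_module :: "('g, 'x) monoid_scheme \<Rightarrow> 'g cg_mod \<Rightarrow> bool" where
  "cg_module G M \<longleftrightarrow>
     M \<in> hom G (ring_mat TYPE(complex) (cg_dim G M) ()) \<and> M \<one>\<^bsub>G\<^esub> = 1\<^sub>m (cg_dim G M)"

definition cg_submodule :: "('g, 'x) monoid_scheme \<Rightarrow> 'g cg_mod \<Rightarrow> complex vec set \<Rightarrow> bool" where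
  "cg_submodule G M W \<longleftrightarrow>
     VectorSpace.subspace class_ring W (module_vec TYPE(complex) (cg_dim G M)) \<and>
     (\<forall>g\<in>carrier G. \<forall>w\<in>W. M g *\<^sub>v w \<in> W)"

definition cg_simple :: "('g, 'x) monoid_scheme \<Rightarrow> 'g cg_mod \<Rightarrow> bool" where
  "cg_simple G M \<longleftrightarrow> cg_module G M \<and> cg_dim G M \<noteq> 0 \<and>
     (\<forall>W. cg_submodule G M W \<longrightarrow> W = {0\<^sub>v (cg_dim G M)} \<or> W = carrier_vec (cg_dim G M))"

definition cg_iso :: "('g, 'x) monoid_scheme \<Rightarrow> 'g cg_mod \<Rightarrow> 'g cg_mod \<Rightarrow> bool" where
  "cg_iso G M N \<longleftrightarrow> cg_dim G M = cg_dim G N \<and>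
     (\<exists>P \<in> carrier_mat (cg_dim G M) (cg_dim G M). invertible_mat P \<and>
        (\<forall>g\<in>carrier G. P * M g = N g * P))"

definition cg_sum :: "'g cg_mod \<Rightarrow> 'g cg_mod \<Rightarrow> 'g cg_mod" where
  "cg_sum M N = (\<lambda>g. diag_block_mat [M g, N g])"

definition kronecker :: "complex mat \<Rightarrow> complex mat \<Rightarrow> complex mat" where
  "kronecker A B = mat (dim_row A * dim_row B) (dim_col A * dim_col B)
     (\<lambda>(i, j). A $$ (i div dim_row B, j div dim_col B) * B $$ (i mod dim_row B, j mod dim_col B))"

text \<open>Tensor product over $\mathbb{C}$ with the diagonal action of \<open>G\<close>.\<close>

definition cg_tensor :: "'g cg_mod \<Rightarrow> 'g cg_mod \<Rightarrow> 'g cg_mod" where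
  "cg_tensor M N = (\<lambda>g. kronecker (M g) (N g))"

text \<open>
  The left regular module $\mathbb{C}[G]$, in the basis of group elements listed by an arbitrary
  enumeration \<open>e\<close>; the column \<open>j\<close> of the matrix of \<open>g\<close> is the basis vector of the
  element \<open>g e\<^sub>j\<close>.
\<close>

definition regular_module :: "('g, 'x) monoid_scheme \<Rightarrow> 'g cg_mod" where
  "regular_module G =
     (let e = (SOME e. bij_betw e {..<Coset.order G} (carrier G))
      in (\<lambda>g. mat (Coset.order G) (Coset.order G) (\<lambda>(i, j). if e i = g \<otimes>\<^bsub>G\<^esub> e j then 1 else 0)))"

text \<open>
  The additive group of the representation ring is the Grothendieck group of $\mathbb{C}[G]$-modules
  under direct sum: the free abelian group on all modules, modulo the subgroup \<open>rep_null\<close>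
  generated by $[M] - [N]$ for $M \cong N$ and $[M \oplus N] - [M] - [N]$.
\<close>

definition rep_null :: "('g, 'x) monoid_scheme \<Rightarrow> ('g cg_mod \<Rightarrow>\<^sub>0 int) set" where
  "rep_null G = generate (free_Abelian_group {M. cg_module G M})
     ({frag_of M - frag_of N | M N. cg_module G M \<and> cg_module G N \<and> cg_iso G M N} \<union>
      {frag_of (cg_sum M N) - frag_of M - frag_of N | M N. cg_module G M \<and> cg_module G N})"

definition rep_class ::
  "('g, 'x) monoid_scheme \<Rightarrow> ('g cg_mod \<Rightarrow>\<^sub>0 int) \<Rightarrow> ('g cg_mod \<Rightarrow>\<^sub>0 int) set" where
  "rep_class G x = rep_null G #>\<^bsub>free_Abelian_group {M. cg_module G M}\<^esub> x"

definition virtual_modules :: "('g, 'x) monoid_scheme \<Rightarrow> ('g cg_mod \<Rightarrow>\<^sub>0 int) set" where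
  "virtual_modules G = carrier (free_Abelian_group {S. cg_simple G S})"

text \<open>
  \<open>frag_extend\<close> extends $S \mapsto [M \otimes S]$ additively to virtual modules.  For a nonzero
  module over a finite group the set of admissible \<open>m\<close> is nonempty (it contains the dimension),
  so \<open>LEAST\<close> is meaningful; \<open>knutson_index\<close> is only meant to be used in this case.
\<close>

definition knutson_index :: "('g, 'x) monoid_scheme \<Rightarrow> 'g cg_mod \<Rightarrow> nat" where
  "knutson_index G M =
     (LEAST m. m \<ge> 1 \<and> (\<exists>N \<in> virtual_modules G.
        rep_class G (frag_extend (\<lambda>S. frag_of (cg_tensor M S)) N) =
        rep_class G (frag_cmul (int m) (frag_of (regular_module G)))))"

definition knutson_type :: "('g, 'x) monoid_scheme \<Rightarrow> bool" where
  "knutson_type G \<longleftrightarrow> (\<forall>M. cg_simple G M \<longrightarrow> knutson_index G M = 1)"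

text \<open>
  The dihedral group of order $2n$ as the semidirect product of $\mathbb{Z}/n$ by the inversion:
  \<open>(i, a)\<close> stands for $r^i s^a$, where $r^n = s^2 = 1$ and $s r s = r^{-1}$.
\<close>

definition dihedral_group :: "nat \<Rightarrow> (int \<times> bool) monoid" where
  "dihedral_group n =
     \<lparr>carrier = {0..<int n} \<times> UNIV,
      monoid.mult = (\<lambda>(i, a) (j, b). ((if a then i - j else i + j) mod int n, a \<noteq> b)),
      one = (0, False)\<rparr>"

lemma group_dihedral_group:
  assumes "n \<ge> 1"
  shows "group (dihedral_group n)"
proof (rule groupI)
  fix x assume "x \<in> carrier (dihedral_group n)"
  then obtain i a where x: "x = (i, a)" "0 \<le> i" "i < int n"
    by (auto simp: dihedral_group_def)
  have "((if a then i else (- i) mod int n), a) \<in> carrier (dihedral_group n)"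
    using x assms by (auto simp: dihedral_group_def)
  moreover have "((if a then i else (- i) mod int n), a) \<otimes>\<^bsub>dihedral_group n\<^esub> x = \<one>\<^bsub>dihedral_group n\<^esub>"
    using x by (auto simp: dihedral_group_def mod_simps)
  ultimately show "\<exists>y\<in>carrier (dihedral_group n). y \<otimes>\<^bsub>dihedral_group n\<^esub> x = \<one>\<^bsub>dihedral_group n\<^esub>"
    by blast
qed (use assms in \<open>auto simp: dihedral_group_def mod_simps algebra_simps\<close>)

lemma order_dihedral_group: "Coset.order (dihedral_group n) = 2 * n"
  by (simp add: Coset.order_def dihedral_group_def card_cartesian_product)

end

theory Submission
  imports Defs "Jordan_Normal_Form.Spectral_Radius"
begin

text \<open>
  Let $r$ and $s$ be the generating rotation and reflection. For every $z$ with $z^n = 1$ there is a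
  plane \<open>dih_plane z\<close> on which $r$ acts as $\mathrm{diag}(z, z^{-1})$ and $s$ exchanges the basis
  vectors. It is the module induced from a character of the rotation subgroup, and the regular module
  is the sum of these planes over all $n$-th roots of unity $z$ (\<open>regular_decomposition\<close>; the
  isomorphism is a Fourier transform, \<open>cg_iso_regular\<close>). An eigenvector of $r$ and its image under
  $s$ span a submodule, so a simple module is either a plane or a line \<open>dih_char c e\<close> on which $r$
  and $s$ act as signs $c$ and $e$ (\<open>simple_module_cases\<close>).

  In the representation ring, write $V_z$ for the class of a plane. A line $L$ with rotation sign $c$
  satisfies $L V_z = V_{cz}$, so $L$ times the regular module is again the regular module. For a plane,
  $V_x V_z = V_{xz} + V_{x/z}$ and $V_x L = V_{xc}$. Hence, if $N$ is the sum of one line with rotation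
  sign $z$ and reflection sign 1 for each root of unity $z = \pm 1$ and of $V_z$ for one $z$ out of each
  pair of conjugate roots of unity, then $V_x N$ is the sum of $V_{xz}$ over all roots of unity $z$,
  which is the regular module. Group theoretically, $N$ is induced from the trivial module of the
  subgroup generated by $s$, and $V_x$ restricts to the regular module of that subgroup.

  A virtual module is a combination of simple modules. The plane $V_z$ is simple unless $z^2 = 1$, and
  in the exceptional case it splits into two lines (\<open>rep_eq_dih_char_pair\<close>), which have to be used in
  its place.
\<close>

section \<open>Modules, submodules and isomorphisms\<close>

lemma cg_moduleI:
  assumes "\<And>g. g \<in> carrier G \<Longrightarrow> M g \<in> carrier_mat d d"
    and "\<And>g h. g \<in> carrier G \<Longrightarrow> h \<in> carrier G \<Longrightarrow> M (g \<otimes>\<^bsub>G\<^esub> h) = M g * M h"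
    and "M \<one>\<^bsub>G\<^esub> = 1\<^sub>m d"
  shows "cg_module G M"
  using assms by (auto simp: cg_module_def cg_dim_def hom_def ring_mat_def)

lemma cg_module_carrier:
  "cg_module G M \<Longrightarrow> g \<in> carrier G \<Longrightarrow> M g \<in> carrier_mat (cg_dim G M) (cg_dim G M)"
  by (auto simp: cg_module_def hom_def ring_mat_def)

lemma cg_module_mult:
  "cg_module G M \<Longrightarrow> g \<in> carrier G \<Longrightarrow> h \<in> carrier G \<Longrightarrow> M (g \<otimes>\<^bsub>G\<^esub> h) = M g * M h"
  by (auto simp: cg_module_def hom_def ring_mat_def)

lemma cg_module_one: "cg_module G M \<Longrightarrow> M \<one>\<^bsub>G\<^esub> = 1\<^sub>m (cg_dim G M)"
  by (simp add: cg_module_def)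

lemma cg_submodule_iff:
  "cg_submodule G M W \<longleftrightarrow> W \<subseteq> carrier_vec (cg_dim G M) \<and> 0\<^sub>v (cg_dim G M) \<in> W \<and>
     (\<forall>v\<in>W. \<forall>w\<in>W. v + w \<in> W) \<and> (\<forall>c. \<forall>v\<in>W. c \<cdot>\<^sub>v v \<in> W) \<and>
     (\<forall>g\<in>carrier G. \<forall>w\<in>W. M g *\<^sub>v w \<in> W)"
proof -
  have "vectorspace class_ring (module_vec TYPE(complex) (cg_dim G M))"
    by (rule vec_vs)
  moreover from this have "Module.module class_ring (module_vec TYPE(complex) (cg_dim G M))"
    by (simp add: vectorspace_def)
  ultimately show ?thesis
    by (auto simp: cg_submodule_def VectorSpace.subspace_def submodule_def module_vec_simps)
qed

section \<open>Right inverses of complex matrices\<close>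

lemma invertible_matI:
  fixes P Q :: "complex mat"
  assumes "P \<in> carrier_mat d d" "Q \<in> carrier_mat d d" "P * Q = 1\<^sub>m d"
  shows "invertible_mat P"
  using assms mat_mult_left_right_inverse[OF assms]
  by (auto simp: invertible_mat_def inverts_mat_def)

text \<open>
  Padding by zeros makes \<open>P\<close> and \<open>Q\<close> square with product still the identity; for square matrices
  the reversed product is then also the identity, although the padded \<open>Q\<close> has a zero row.
\<close>

lemma right_inverse_imp_le:
  fixes P Q :: "complex mat"
  assumes P: "P \<in> carrier_mat d k" and Q: "Q \<in> carrier_mat k d" and PQ: "P * Q = 1\<^sub>m d"
  shows "d \<le> k"
proof (rule ccontr)
  assume "\<not> d \<le> k"
  hence kd: "k < d" by simp
  define A where "A = mat d d (\<lambda>(i, j). if j < k then P $$ (i, j) else 0)"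
  define B where "B = mat d d (\<lambda>(i, j). if i < k then Q $$ (i, j) else 0)"
  have AB: "A \<in> carrier_mat d d" "B \<in> carrier_mat d d" by (auto simp: A_def B_def)
  have "A * B = 1\<^sub>m d"
  proof (rule eq_matI)
    fix i j assume "i < dim_row (1\<^sub>m d)" "j < dim_col (1\<^sub>m d)"
    hence ij: "i < d" "j < d" by auto
    have "(A * B) $$ (i, j) = (\<Sum>l\<in>{0..<d}. (if l < k then P $$ (i, l) * Q $$ (l, j) else 0))"
      using ij by (auto simp: A_def B_def scalar_prod_def intro!: sum.cong)
    also have "\<dots> = (\<Sum>l\<in>{0..<k}. P $$ (i, l) * Q $$ (l, j))"
      using kd by (intro sum.mono_neutral_cong_right) auto
    also have "\<dots> = (P * Q) $$ (i, j)" using P Q ij by (simp add: scalar_prod_def)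
    finally show "(A * B) $$ (i, j) = 1\<^sub>m d $$ (i, j)" by (simp only: PQ)
  qed (auto simp: A_def B_def)
  from mat_mult_left_right_inverse[OF AB this] have "(B * A) $$ (k, k) = 1" using kd by simp
  moreover have "(B * A) $$ (k, k) = 0" using kd by (simp add: A_def B_def scalar_prod_def)
  ultimately show False by simp
qed

lemma surjective_imp_right_inverse:
  fixes P :: "complex mat"
  assumes P: "P \<in> carrier_mat d k" and surj: "(\<lambda>x. P *\<^sub>v x) ` carrier_vec k = carrier_vec d"
  shows "\<exists>Q \<in> carrier_mat k d. P * Q = 1\<^sub>m d"
proof -
  have "\<exists>x \<in> carrier_vec k. P *\<^sub>v x = unit_vec d j" for j
    using surj unit_vec_carrier[of d j] by (metis (no_types, lifting) imageE)
  then obtain x where x: "\<And>j. x j \<in> carrier_vec k" "\<And>j. P *\<^sub>v x j = unit_vec d j" by metis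
  define Q where "Q = mat k d (\<lambda>(i, j). x j $ i)"
  have "P * Q = 1\<^sub>m d"
  proof (rule eq_matI)
    fix i j assume "i < dim_row (1\<^sub>m d)" "j < dim_col (1\<^sub>m d)"
    hence ij: "i < d" "j < d" by auto
    have "col Q j = x j" using x(1)[of j] ij by (auto simp: Q_def intro!: eq_vecI)
    hence "(P * Q) $$ (i, j) = (P *\<^sub>v x j) $ i" using P ij by (simp add: Q_def)
    thus "(P * Q) $$ (i, j) = 1\<^sub>m d $$ (i, j)" using ij by (simp add: x(2))
  qed (use P in \<open>auto simp: Q_def\<close>)
  thus ?thesis by (intro bexI[of _ Q]) (auto simp: Q_def)
qed

section \<open>Direct sums and tensor products\<close>

lemma diag_block_mat_pair:
  "diag_block_mat [A, B] =
     four_block_mat A (0\<^sub>m (dim_row A) (dim_col B)) (0\<^sub>m (dim_row B) (dim_col A)) B"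
  by (simp only: diag_block_mat.simps(2)[of A] diag_block_mat_singleton Let_def)

lemma cg_sum_apply:
  "cg_sum M N g = four_block_mat (M g) (0\<^sub>m (dim_row (M g)) (dim_col (N g)))
     (0\<^sub>m (dim_row (N g)) (dim_col (M g))) (N g)"
  unfolding cg_sum_def by (rule diag_block_mat_pair)

lemma cg_dim_sum [simp]: "cg_dim G (cg_sum M N) = cg_dim G M + cg_dim G N"
  by (simp add: cg_dim_def cg_sum_apply)

lemma cg_module_sum:
  assumes "cg_module G M" "cg_module G N"
  shows "cg_module G (cg_sum M N)"
proof (rule cg_moduleI[where d = "cg_dim G M + cg_dim G N"])
  fix g assume g: "g \<in> carrier G"
  note car = cg_module_carrier[OF assms(1)] cg_module_carrier[OF assms(2)]
  show "cg_sum M N g \<in> carrier_mat (cg_dim G M + cg_dim G N) (cg_dim G M + cg_dim G N)"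
    using car[OF g] by (simp add: cg_sum_apply)
  fix h assume h: "h \<in> carrier G"
  let ?m = "cg_dim G M" and ?n = "cg_dim G N"
  have "four_block_mat (M g) (0\<^sub>m ?m ?n) (0\<^sub>m ?n ?m) (N g) *
        four_block_mat (M h) (0\<^sub>m ?m ?n) (0\<^sub>m ?n ?m) (N h) =
        four_block_mat (M g * M h) (0\<^sub>m ?m ?n) (0\<^sub>m ?n ?m) (N g * N h)"
    using car[OF g] car[OF h]
    by (subst mult_four_block_mat[where ?nr1.0 = ?m and ?n1.0 = ?m and ?n2.0 = ?n and ?nr2.0 = ?n
          and ?nc1.0 = ?m and ?nc2.0 = ?n]) auto
  thus "cg_sum M N (g \<otimes>\<^bsub>G\<^esub> h) = cg_sum M N g * cg_sum M N h"
    using car[OF g] car[OF h]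
    by (simp add: cg_sum_apply cg_module_mult[OF assms(1) g h]
        cg_module_mult[OF assms(2) g h])
next
  show "cg_sum M N \<one>\<^bsub>G\<^esub> = 1\<^sub>m (cg_dim G M + cg_dim G N)"
    by (rule eq_matI) (auto simp: cg_sum_apply cg_module_one[OF assms(1)]
        cg_module_one[OF assms(2)])
qed

lemma sum_div_mod:
  fixes f :: "nat \<Rightarrow> nat \<Rightarrow> 'a :: comm_monoid_add"
  shows "(\<Sum>k<m * n. f (k div n) (k mod n)) = (\<Sum>i<m. \<Sum>j<n. f i j)"
proof -
  have bound: "i * n + j < m * n" if "i < m" "j < n" for i j
  proof -
    have "i * n + j < Suc i * n" using that by simp
    also have "\<dots> \<le> m * n" using that by (intro mult_le_mono1) simp
    finally show ?thesis .
  qed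
  have "(\<Sum>k<m * n. f (k div n) (k mod n)) = (\<Sum>(i, j)\<in>{..<m} \<times> {..<n}. f i j)"
  proof (rule sum.reindex_bij_witness[where i = "\<lambda>(i, j). i * n + j" and j = "\<lambda>k. (k div n, k mod n)"])
    fix k assume "k \<in> {..<m * n}"
    moreover from this have "n > 0" by (cases n) auto
    ultimately show "(k div n, k mod n) \<in> {..<m} \<times> {..<n}"
      by (auto intro: less_mult_imp_div_less)
  qed (auto simp: bound)
  thus ?thesis by (simp add: sum.cartesian_product)
qed

lemma sum_mult_indicator:
  fixes f :: "nat \<Rightarrow> complex"
  assumes "finite A" "k \<in> A"
  shows "(\<Sum>l\<in>A. f l * (if l = k then 1 else 0)) = f k"
proof -
  have "(\<Sum>l\<in>A. f l * (if l = k then 1 else 0)) = (\<Sum>l\<in>A. if l = k then f l else 0)"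
    by (intro sum.cong) auto
  thus ?thesis using assms by simp
qed

lemma kronecker_carrier [simp]:
  "A \<in> carrier_mat a b \<Longrightarrow> B \<in> carrier_mat p q \<Longrightarrow> kronecker A B \<in> carrier_mat (a * p) (b * q)"
  by (auto simp: kronecker_def)

text \<open>
  This is the mixed product property; it makes the tensor product a module and transports
  isomorphisms through it.
\<close>

lemma kronecker_mult:
  assumes A: "A \<in> carrier_mat a b" and B: "B \<in> carrier_mat p q"
    and C: "C \<in> carrier_mat b c" and D: "D \<in> carrier_mat q r"
  shows "kronecker A B * kronecker C D = kronecker (A * C) (B * D)"
proof (rule eq_matI)
  fix i j assume "i < dim_row (kronecker (A * C) (B * D))" "j < dim_col (kronecker (A * C) (B * D))"
  hence i: "i < a * p" and j: "j < c * r" using assms by (auto simp: kronecker_def)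
  have pos: "p > 0" "r > 0" using i j by (auto intro: Nat.gr0I)
  have ij: "i div p < a" "j div r < c" "i mod p < p" "j mod r < r"
    using i j pos by (auto intro: less_mult_imp_div_less)
  have "(kronecker A B * kronecker C D) $$ (i, j) =
     (\<Sum>k<b * q. A $$ (i div p, k div q) * B $$ (i mod p, k mod q) *
        (C $$ (k div q, j div r) * D $$ (k mod q, j mod r)))"
    using assms i j by (auto simp: kronecker_def scalar_prod_def lessThan_atLeast0)
  also have "\<dots> = (\<Sum>k<b. \<Sum>l<q. A $$ (i div p, k) * B $$ (i mod p, l) * (C $$ (k, j div r) * D $$ (l, j mod r)))"
    by (rule sum_div_mod)
  also have "\<dots> = (\<Sum>k<b. A $$ (i div p, k) * C $$ (k, j div r)) *
      (\<Sum>l<q. B $$ (i mod p, l) * D $$ (l, j mod r))"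
    by (simp add: sum_product mult_ac)
  also have "\<dots> = kronecker (A * C) (B * D) $$ (i, j)"
    using assms i j ij by (auto simp: kronecker_def scalar_prod_def lessThan_atLeast0)
  finally show "(kronecker A B * kronecker C D) $$ (i, j) = kronecker (A * C) (B * D) $$ (i, j)" .
qed (use assms in \<open>auto simp: kronecker_def\<close>)

lemma kronecker_one [simp]: "kronecker (1\<^sub>m a) (1\<^sub>m b) = 1\<^sub>m (a * b)"
proof (rule eq_matI)
  fix i j assume "i < dim_row (1\<^sub>m (a * b))" "j < dim_col (1\<^sub>m (a * b))"
  hence i: "i < a * b" and j: "j < a * b" by auto
  have "b > 0" using i by (auto intro: Nat.gr0I)
  hence "i div b < a" "j div b < a" "i mod b < b" "j mod b < b"
    using i j by (auto intro: less_mult_imp_div_less)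
  moreover have "i = j \<longleftrightarrow> i div b = j div b \<and> i mod b = j mod b"
    using div_mult_mod_eq[of i b] div_mult_mod_eq[of j b] by metis
  ultimately show "kronecker (1\<^sub>m a) (1\<^sub>m b) $$ (i, j) = 1\<^sub>m (a * b) $$ (i, j)"
    using i j by (auto simp: kronecker_def)
qed (auto simp: kronecker_def)

lemma cg_dim_tensor [simp]: "cg_dim G (cg_tensor M N) = cg_dim G M * cg_dim G N"
  by (simp add: cg_dim_def cg_tensor_def kronecker_def)

lemma cg_module_tensor:
  assumes M: "cg_module G M" and N: "cg_module G N"
  shows "cg_module G (cg_tensor M N)"
proof (rule cg_moduleI[where d = "cg_dim G M * cg_dim G N"])
  fix g assume g: "g \<in> carrier G"
  show "cg_tensor M N g \<in> carrier_mat (cg_dim G M * cg_dim G N) (cg_dim G M * cg_dim G N)"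
    using cg_module_carrier[OF M g] cg_module_carrier[OF N g] by (simp add: cg_tensor_def)
  fix h assume h: "h \<in> carrier G"
  show "cg_tensor M N (g \<otimes>\<^bsub>G\<^esub> h) = cg_tensor M N g * cg_tensor M N h"
    using kronecker_mult[OF cg_module_carrier[OF M g] cg_module_carrier[OF N g]
        cg_module_carrier[OF M h] cg_module_carrier[OF N h]]
    by (simp add: cg_tensor_def cg_module_mult[OF M g h] cg_module_mult[OF N g h])
qed (simp add: cg_tensor_def cg_module_one[OF M] cg_module_one[OF N])

lemma cg_isoI:
  assumes "cg_dim G M = d" "cg_dim G N = d" "P \<in> carrier_mat d d" "Q \<in> carrier_mat d d"
    "P * Q = 1\<^sub>m d" "\<And>g. g \<in> carrier G \<Longrightarrow> P * M g = N g * P"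
  shows "cg_iso G M N"
  unfolding cg_iso_def assms(1,2) using assms(3,6) invertible_matI[OF assms(3-5)] by blast

lemma cg_iso_tensor:
  assumes "cg_iso G M M'" and M: "cg_module G M" and M': "cg_module G M'" and S: "cg_module G S"
  shows "cg_iso G (cg_tensor M S) (cg_tensor M' S)"
proof -
  define d where "d = cg_dim G M"
  from assms(1) obtain P where P: "P \<in> carrier_mat d d" "invertible_mat P"
     and d: "cg_dim G M' = d" and PM: "\<And>g. g \<in> carrier G \<Longrightarrow> P * M g = M' g * P"
    unfolding cg_iso_def d_def by metis
  from P obtain Q where Q: "P * Q = 1\<^sub>m d" and QP: "Q * P = 1\<^sub>m (dim_row Q)"
    by (auto simp: invertible_mat_def inverts_mat_def)
  have "Q \<in> carrier_mat d d"
    using P(1) arg_cong[OF Q, of dim_col] arg_cong[OF QP, of dim_col] by auto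
  note Q = Q this
  let ?I = "1\<^sub>m (cg_dim G S)"
  have I: "?I \<in> carrier_mat (cg_dim G S) (cg_dim G S)" by simp
  show ?thesis
  proof (rule cg_isoI[where P = "kronecker P ?I" and Q = "kronecker Q ?I"])
    show "kronecker P ?I * kronecker Q ?I = 1\<^sub>m (d * cg_dim G S)"
      using kronecker_mult[OF P(1) I Q(2) I] Q by simp
    fix g assume g: "g \<in> carrier G"
    have Mg: "M g \<in> carrier_mat d d" "M' g \<in> carrier_mat d d" "S g \<in> carrier_mat (cg_dim G S) (cg_dim G S)"
      using cg_module_carrier[OF M g] cg_module_carrier[OF M' g] cg_module_carrier[OF S g]
      by (auto simp: d_def d[unfolded d_def])
    show "kronecker P ?I * cg_tensor M S g = cg_tensor M' S g * kronecker P ?I"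
      unfolding cg_tensor_def
      using kronecker_mult[OF P(1) I Mg(1,3)] kronecker_mult[OF Mg(2,3) P(1) I] PM[OF g] Mg by simp
  qed (use P Q in \<open>auto simp: d d_def\<close>)
qed

section \<open>Congruence in the representation ring\<close>

text \<open>
  Congruence modulo \<open>rep_null\<close> is the form in which all computations in the representation ring
  are carried out; compared with equality of cosets it needs no membership side conditions.
\<close>

definition rep_eq :: "('g, 'x) monoid_scheme \<Rightarrow> ('g cg_mod \<Rightarrow>\<^sub>0 int) \<Rightarrow> ('g cg_mod \<Rightarrow>\<^sub>0 int) \<Rightarrow> bool"
  where "rep_eq G x y \<longleftrightarrow> x - y \<in> rep_null G"

lemma subgroup_rep_null: "subgroup (rep_null G) (free_Abelian_group {M. cg_module G M})"
proof -
  have "Poly_Mapping.keys (frag_of M - frag_of N) \<subseteq> {M. cg_module G M}"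
    if "cg_module G M" "cg_module G N" for M N
    using that keys_diff[of "frag_of M" "frag_of N"] by (auto simp: keys_frag_of)
  moreover have "Poly_Mapping.keys (frag_of (cg_sum M N) - frag_of M - frag_of N) \<subseteq> {M. cg_module G M}"
    if "cg_module G M" "cg_module G N" for M N
    using that cg_module_sum[OF that] keys_diff[of "frag_of (cg_sum M N) - frag_of M" "frag_of N"]
       keys_diff[of "frag_of (cg_sum M N)" "frag_of M"]  by (auto simp: keys_frag_of)
  ultimately show ?thesis
    unfolding rep_null_def by (intro group.generate_is_subgroup) auto
qed

lemma rep_null_0: "0 \<in> rep_null G"
  using subgroup.one_closed[OF subgroup_rep_null] by simp

lemma rep_null_add: "x \<in> rep_null G \<Longrightarrow> y \<in> rep_null G \<Longrightarrow> x + y \<in> rep_null G"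
  using subgroup.m_closed[OF subgroup_rep_null] by fastforce

lemma rep_null_minus: "x \<in> rep_null G \<Longrightarrow> - x \<in> rep_null G"
  using subgroup.m_inv_closed[OF subgroup_rep_null, of x G] subgroup.subset[OF subgroup_rep_null, of G]
  by (auto simp: subset_iff)

lemma rep_eq_refl: "rep_eq G x x"
  by (simp add: rep_eq_def rep_null_0)

lemma rep_eq_sym: "rep_eq G x y \<Longrightarrow> rep_eq G y x"
  using rep_null_minus[of "x - y" G] by (simp add: rep_eq_def)

lemma rep_eq_trans [trans]: "rep_eq G x y \<Longrightarrow> rep_eq G y z \<Longrightarrow> rep_eq G x z"
  using rep_null_add[of "x - y" G "y - z"] by (simp add: rep_eq_def)

lemma rep_eq_add: "rep_eq G x y \<Longrightarrow> rep_eq G x' y' \<Longrightarrow> rep_eq G (x + x') (y + y')"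
  using rep_null_add[of "x - y" G "x' - y'"] by (simp add: rep_eq_def algebra_simps)

lemma rep_eq_sum: "(\<And>i. i \<in> I \<Longrightarrow> rep_eq G (f i) (g i)) \<Longrightarrow> rep_eq G (sum f I) (sum g I)"
  by (induction I rule: infinite_finite_induct) (auto simp: rep_eq_refl rep_eq_add)

lemma rep_eq_iso: "cg_module G M \<Longrightarrow> cg_module G N \<Longrightarrow> cg_iso G M N \<Longrightarrow> rep_eq G (frag_of M) (frag_of N)"
  unfolding rep_eq_def rep_null_def by (rule generate.incl) blast

lemma rep_eq_cg_sum:
  assumes "cg_module G M" "cg_module G N"
  shows "rep_eq G (frag_of (cg_sum M N)) (frag_of M + frag_of N)"
proof -
  have "frag_of (cg_sum M N) - frag_of M - frag_of N \<in> rep_null G"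
    unfolding rep_null_def using assms by (intro generate.incl) blast
  thus ?thesis by (simp add: rep_eq_def diff_diff_eq)
qed

lemma rep_class_eqI:
  assumes "rep_eq G x y"
  shows "rep_class G x = rep_class G y"
proof -
  have *: "rep_class G x \<subseteq> rep_class G y" if "rep_eq G x y" for x y
  proof
    fix z assume "z \<in> rep_class G x"
    then obtain h where h: "h \<in> rep_null G" "z = h + x" by (auto simp: rep_class_def r_coset_def)
    hence "z = (h + (x - y)) + y" by simp
    moreover have "h + (x - y) \<in> rep_null G" using h that by (intro rep_null_add) (auto simp: rep_eq_def)
    ultimately show "z \<in> rep_class G y" unfolding rep_class_def r_coset_def by fastforce
  qed
  show ?thesis using *[OF assms] *[OF rep_eq_sym[OF assms]] by blast
qed

lemma knutson_index_eq_1I: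
  assumes "Poly_Mapping.keys N \<subseteq> {S. cg_simple G S}"
    and "rep_eq G (frag_extend (\<lambda>S. frag_of (cg_tensor M S)) N) (frag_of (regular_module G))"
  shows "knutson_index G M = 1"
  unfolding knutson_index_def
  using assms by (intro Least_equality) (auto simp: virtual_modules_def intro!: bexI[of _ N] rep_class_eqI)

text \<open>
  \<open>M \<oplus> M\<close> is isomorphic to \<open>M\<close> when \<open>M\<close> is zero, which gives $2[M] = [M]$.
\<close>

lemma rep_eq_zero_dim:
  assumes M: "cg_module G M" and d: "cg_dim G M = 0"
  shows "rep_eq G (frag_of M) 0"
proof -
  have c: "M g \<in> carrier_mat 0 0" if "g \<in> carrier G" for g
    using cg_module_carrier[OF M that] d by simp
  have "cg_iso G (cg_sum M M) M"
  proof (rule cg_isoI[where d = 0 and P = "1\<^sub>m 0" and Q = "1\<^sub>m 0"])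
    fix g assume "g \<in> carrier G"
    thus "1\<^sub>m 0 * cg_sum M M g = M g * 1\<^sub>m 0"
      using c[of g] by (intro eq_matI) (auto simp: cg_sum_apply)
  qed (use d in auto)
  hence "rep_eq G (frag_of (cg_sum M M)) (frag_of M)"
    using M by (intro rep_eq_iso cg_module_sum)
  hence "rep_eq G (frag_of M + frag_of M) (frag_of M)"
    using rep_eq_trans[OF rep_eq_sym[OF rep_eq_cg_sum[OF M M]]] by blast
  thus ?thesis by (simp add: rep_eq_def)
qed

lemma add_closed_free_Abelian_group:
  "x \<in> carrier (free_Abelian_group S) \<Longrightarrow> y \<in> carrier (free_Abelian_group S) \<Longrightarrow>
    x + y \<in> carrier (free_Abelian_group S)"
  using keys_add[of x y] by auto

section \<open>The dihedral group and its modules of dimension one and two\<close>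

text \<open>
  The rotation by one step acts as \<open>c\<close> and the reflection \<open>(0, True)\<close> as \<open>e\<close>. This is a
  module when both are signs and $c^n = 1$.
\<close>

definition dih_char :: "complex \<Rightarrow> complex \<Rightarrow> (int \<times> bool) cg_mod" where
  "dih_char c e = (\<lambda>(i, a). mat 1 1 (\<lambda>_. c powi i * (if a then e else 1)))"

text \<open>
  The module induced from the character of the rotation subgroup with value \<open>z\<close>, where $z^n = 1$:
  the rotation acts as $\mathrm{diag}(z, z^{-1})$ and the reflection exchanges the two basis vectors.
  It is simple unless $z^2 = 1$.
\<close>

definition dih_plane :: "complex \<Rightarrow> (int \<times> bool) cg_mod" where
  "dih_plane z = (\<lambda>(i, a). mat 2 2 (\<lambda>(p, q). if (p = q) = a then 0 else if p = 0 then z powi i else z powi - i))"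

context
  fixes n :: nat
  assumes n_pos: "n \<ge> 1"
begin

abbreviation D where "D \<equiv> dihedral_group n"
text \<open>For $n = 1$ the rotation is the identity, whose first component is 0 and not 1.\<close>

abbreviation rot :: "int \<times> bool" where "rot \<equiv> (1 mod int n, False)"
abbreviation refl :: "int \<times> bool" where "refl \<equiv> (0, True)"

lemma carrier_D: "carrier D = {0..<int n} \<times> UNIV"
  by (simp add: dihedral_group_def)

lemma mult_D: "(i, a) \<otimes>\<^bsub>D\<^esub> (j, b) = ((if a then i - j else i + j) mod int n, a \<noteq> b)"
  by (simp add: dihedral_group_def)

lemma one_D: "\<one>\<^bsub>D\<^esub> = (0, False)"
  by (simp add: dihedral_group_def)

lemma rot_refl_D: "rot \<in> carrier D" "refl \<in> carrier D"
  using n_pos by (auto simp: carrier_D)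

text \<open>
  Every element is $r^i$ or $r^i s$, reached from the identity or from the reflection $s$ by rotations.
\<close>

lemma dihedral_induct [consumes 1, case_names one refl rot]:
  assumes g: "g \<in> carrier D" and 1: "Q \<one>\<^bsub>D\<^esub>" and s: "Q refl"
    and r: "\<And>g. g \<in> carrier D \<Longrightarrow> Q g \<Longrightarrow> Q (rot \<otimes>\<^bsub>D\<^esub> g)"
  shows "Q g"
proof -
  have *: "Q (int k, a)" if "k < n" for k a
    using that
  proof (induction k)
    case 0
    thus ?case using 1 s by (cases a) (auto simp: one_D)
  next
    case (Suc k)
    have "rot \<otimes>\<^bsub>D\<^esub> (int k, a) = (int (Suc k), a)"
      using Suc.prems by (simp add: mult_D mod_simps)
    thus ?case using r[of "(int k, a)"] Suc by (auto simp: carrier_D)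
  qed
  obtain i a where ia: "g = (i, a)" "0 \<le> i" "i < int n" using g by (auto simp: carrier_D)
  thus ?thesis using *[of "nat i" a] by simp
qed

text \<open>
  An intertwining relation needs to be checked on the two generators only. The matrix may be
  rectangular, as is the one that maps a plane into an arbitrary simple module.
\<close>

lemma intertwine_generators:
  assumes X: "cg_module D X" and Y: "cg_module D Y"
    and P: "P \<in> carrier_mat (cg_dim D Y) (cg_dim D X)"
    and r: "P * X rot = Y rot * P" and s: "P * X refl = Y refl * P"
    and g: "g \<in> carrier D"
  shows "P * X g = Y g * P"
  using g
proof (induction rule: dihedral_induct)
  case one
  show ?case using P by (simp add: cg_module_one[OF X] cg_module_one[OF Y])
next
  case refl
  show ?case by (rule s)
next
  case (rot g)
  note car = cg_module_carrier[OF X rot(1)] cg_module_carrier[OF Y rot(1)]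
    cg_module_carrier[OF X rot_refl_D(1)] cg_module_carrier[OF Y rot_refl_D(1)]
  have "P * X (rot \<otimes>\<^bsub>D\<^esub> g) = P * (X rot * X g)"
    by (simp only: cg_module_mult[OF X rot_refl_D(1) rot(1)])
  also have "\<dots> = (P * X rot) * X g" by (rule assoc_mult_mat[symmetric, OF P car(3,1)])
  also have "\<dots> = (Y rot * P) * X g" by (simp only: r)
  also have "\<dots> = Y rot * (P * X g)" by (rule assoc_mult_mat[OF car(4) P car(1)])
  also have "\<dots> = Y rot * (Y g * P)" by (simp only: rot(2))
  also have "\<dots> = (Y rot * Y g) * P" by (rule assoc_mult_mat[symmetric, OF car(4,2) P])
  also have "\<dots> = Y (rot \<otimes>\<^bsub>D\<^esub> g) * P"
    by (simp only: cg_module_mult[OF Y rot_refl_D(1) rot(1)])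
  finally show ?case .
qed

lemma rep_eq_by_generators:
  assumes X: "cg_module D X" and Y: "cg_module D Y" and d: "cg_dim D X = d" "cg_dim D Y = d"
    and P: "P \<in> carrier_mat d d" "Q \<in> carrier_mat d d" "P * Q = 1\<^sub>m d"
    and rs: "P * X rot = Y rot * P" "P * X refl = Y refl * P"
  shows "rep_eq D (frag_of X) (frag_of Y)"
proof (intro rep_eq_iso X Y cg_isoI[OF d P])
  have "P \<in> carrier_mat (cg_dim D Y) (cg_dim D X)" using P(1) d by simp
  thus "P * X g = Y g * P" if "g \<in> carrier D" for g
    using rs that by (rule intertwine_generators[OF X Y])
qed

lemma root_nonzero: "z ^ n = (1::complex) \<Longrightarrow> z \<noteq> 0"
  using n_pos by (auto simp: power_0_left)

lemma powi_mod:
  assumes "z ^ n = (1::complex)"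
  shows "z powi (i mod int n) = z powi i"
proof -
  have "z powi i = z powi (int n * (i div int n) + i mod int n)" by simp
  also have "\<dots> = z powi (int n * (i div int n)) * z powi (i mod int n)"
    using root_nonzero[OF assms] by (subst power_int_add) auto
  finally show ?thesis using assms by (simp add: power_int_mult)
qed

lemma powi_minus_mod:
  assumes "z ^ n = (1::complex)"
  shows "z powi - (i mod int n) = z powi - i"
  by (simp add: power_int_minus powi_mod[OF assms])

lemma cg_dim_dih_char [simp]: "cg_dim D (dih_char c e) = 1"
  by (simp add: cg_dim_def one_D dih_char_def)

lemma cg_dim_dih_plane [simp]: "cg_dim D (dih_plane z) = 2"
  by (simp add: cg_dim_def one_D dih_plane_def)

lemma sign_cases: "(c::complex) * c = 1 \<Longrightarrow> c = 1 \<or> c = -1"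
  by (simp add: square_eq_1_iff)

lemma sign_powi:
  assumes "(c::complex) * c = 1"
  shows "c powi - i = c powi i"
proof -
  have "inverse c = c" using assms by (rule inverse_unique)
  thus ?thesis using power_int_minus[of c i] power_int_inverse[of c i] by simp
qed

lemma cg_module_dih_char:
  assumes "c ^ n = 1" "c * c = 1" "e * e = 1"
  shows "cg_module D (dih_char c e)"
proof (rule cg_moduleI[where d = 1])
  fix g h assume "g \<in> carrier D" "h \<in> carrier D"
  obtain i a j b where gh: "g = (i, a)" "h = (j, b)" by (cases g, cases h)
  show "dih_char c e (g \<otimes>\<^bsub>D\<^esub> h) = dih_char c e g * dih_char c e h"
    using root_nonzero[OF assms(1)] assms(3)
    by (intro eq_matI) (auto simp: gh dih_char_def mult_D powi_mod[OF assms(1)] scalar_prod_def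
        power_int_add power_int_diff power_int_minus[symmetric] divide_inverse sign_powi[OF assms(2)] mult_ac)
qed (auto simp: dih_char_def one_D)

lemma cg_module_dih_plane:
  assumes "z ^ n = 1"
  shows "cg_module D (dih_plane z)"
proof (rule cg_moduleI[where d = 2])
  fix g h assume "g \<in> carrier D" "h \<in> carrier D"
  obtain i a j b where gh: "g = (i, a)" "h = (j, b)" by (cases g, cases h)
  have z: "z \<noteq> 0" by (rule root_nonzero[OF assms])
  have add: "z powi (i + j) = z powi i * z powi j"
    "z powi (- i - j) = z powi (- i) * z powi (- j)"
    "z powi (j - i) = z powi (- i) * z powi j"
    "z powi (i - j) = z powi i * z powi (- j)"
    using z power_int_add[of z i j] power_int_add[of z "-i" "-j"] power_int_add[of z "-i" "j"]
      power_int_add[of z "i" "-j"] by auto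
  show "dih_plane z (g \<otimes>\<^bsub>D\<^esub> h) = dih_plane z g * dih_plane z h"
    by (intro eq_matI) (auto simp: gh dih_plane_def mult_D powi_mod[OF assms] powi_minus_mod[OF assms]
         scalar_prod_def add less_2_cases_iff numeral_2_eq_2)
qed (auto simp: dih_plane_def one_D)

lemma dih_char_rot: "c ^ n = 1 \<Longrightarrow> dih_char c e rot = mat 1 1 (\<lambda>_. c)"
  by (simp add: dih_char_def powi_mod)

lemma dih_char_refl: "dih_char c e refl = mat 1 1 (\<lambda>_. e)"
  by (simp add: dih_char_def)

lemma dih_plane_rot: "z ^ n = 1 \<Longrightarrow>
  dih_plane z rot = mat 2 2 (\<lambda>(p, q). if p \<noteq> q then 0 else if p = 0 then z else inverse z)"
  by (auto simp: dih_plane_def powi_mod powi_minus_mod power_int_minus intro!: eq_matI)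

lemma dih_plane_refl: "dih_plane z refl = mat 2 2 (\<lambda>(p, q). if p = q then 0 else 1)"
  by (auto simp: dih_plane_def intro!: eq_matI)

lemma cg_simple_dih_char:
  assumes "c ^ n = 1" "c * c = 1" "e * e = 1"
  shows "cg_simple D (dih_char c e)"
  unfolding cg_simple_def
proof (intro conjI allI impI cg_module_dih_char assms)
  fix W assume "cg_submodule D (dih_char c e) W"
  hence W: "W \<subseteq> carrier_vec 1" "0\<^sub>v 1 \<in> W" "\<And>k v. v \<in> W \<Longrightarrow> k \<cdot>\<^sub>v v \<in> W"
    by (auto simp: cg_submodule_iff)
  have "W = carrier_vec 1" if "W \<noteq> {0\<^sub>v 1}"
  proof -
    from that W(2) obtain w where w: "w \<in> W" "w \<noteq> 0\<^sub>v 1" by blast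
    have w1: "w \<in> carrier_vec 1" using w W by blast
    hence w0: "w $ 0 \<noteq> 0" using w(2) by (auto intro!: eq_vecI)
    have "v \<in> W" if "v \<in> carrier_vec 1" for v
    proof -
      have "v = (v $ 0 / w $ 0) \<cdot>\<^sub>v w" using that w1 w0 by (intro eq_vecI) auto
      thus ?thesis using W(3)[OF w(1)] by metis
    qed
    thus ?thesis using W(1) by blast
  qed
  thus "W = {0\<^sub>v (cg_dim D (dih_char c e))} \<or> W = carrier_vec (cg_dim D (dih_char c e))" by auto
qed simp

text \<open>
  The eigenvalues $z \neq z^{-1}$ of the rotation are distinct, so a nonzero submodule contains one
  of the basis vectors, and the reflection produces the other one.
\<close>

lemma cg_simple_dih_plane:
  assumes z: "z ^ n = 1" and z2: "z * z \<noteq> 1"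
  shows "cg_simple D (dih_plane z)"
  unfolding cg_simple_def
proof (intro conjI allI impI cg_module_dih_plane assms)
  fix W assume "cg_submodule D (dih_plane z) W"
  hence W: "W \<subseteq> carrier_vec 2" "0\<^sub>v 2 \<in> W" "\<And>v w. v \<in> W \<Longrightarrow> w \<in> W \<Longrightarrow> v + w \<in> W"
    "\<And>k v. v \<in> W \<Longrightarrow> k \<cdot>\<^sub>v v \<in> W" "\<And>v. v \<in> W \<Longrightarrow> dih_plane z rot *\<^sub>v v \<in> W"
    "\<And>v. v \<in> W \<Longrightarrow> dih_plane z refl *\<^sub>v v \<in> W"
    using rot_refl_D by (auto simp: cg_submodule_iff)
  have z0: "z \<noteq> 0" by (rule root_nonzero[OF z])
  have dz: "z - inverse z \<noteq> 0" using z2 z0 by (auto simp: field_simps)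
  have rot: "dih_plane z rot *\<^sub>v v = vec 2 (\<lambda>p. if p = 0 then z * v $ 0 else inverse z * v $ 1)"
    and refl: "dih_plane z refl *\<^sub>v v = vec 2 (\<lambda>p. v $ (1 - p))" if "v \<in> carrier_vec 2" for v
    using that by (auto intro!: eq_vecI simp: dih_plane_rot[OF z] dih_plane_refl scalar_prod_def numeral_2_eq_2 less_Suc_eq)
  have "W = carrier_vec 2" if "W \<noteq> {0\<^sub>v 2}"
  proof -
    from that W(2) obtain u where u: "u \<in> W" "u \<noteq> 0\<^sub>v 2" by blast
    have u2: "u \<in> carrier_vec 2" using u W by blast
    have "\<exists>w\<in>W. w $ 0 \<noteq> 0"
    proof (cases "u $ 0 = 0")
      case True
      hence "u $ 1 \<noteq> 0" using u(2) u2 by (auto intro!: eq_vecI simp: less_2_cases_iff)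
      hence "(dih_plane z refl *\<^sub>v u) $ 0 \<noteq> 0" by (simp add: refl[OF u2])
      thus ?thesis using W(6)[OF u(1)] by blast
    qed (use u in blast)
    then obtain w where w: "w \<in> W" "w $ 0 \<noteq> 0" by blast
    have w2: "w \<in> carrier_vec 2" using w W by blast
    \<comment> \<open>Applying the rotation minus $z^{-1}$ kills the second coordinate; \<open>k\<close> normalizes the first.\<close>
    define k where "k = 1 / ((z - inverse z) * w $ 0)"
    have k: "k * (z * w $ 0) - k * (inverse z * w $ 0) = 1"
    proof -
      have "k * ((z - inverse z) * w $ 0) = 1" using dz w(2) by (simp add: k_def)
      thus ?thesis by (simp add: algebra_simps)
    qed
    have "k \<cdot>\<^sub>v (dih_plane z rot *\<^sub>v w + (- inverse z) \<cdot>\<^sub>v w) \<in> W"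
      using W w by blast
    also have "k \<cdot>\<^sub>v (dih_plane z rot *\<^sub>v w + (- inverse z) \<cdot>\<^sub>v w) = vec 2 (\<lambda>p. if p = 0 then 1 else 0)"
      using w2 k by (intro eq_vecI) (auto simp: rot[OF w2] less_2_cases_iff algebra_simps)
    finally have e0: "vec 2 (\<lambda>p. if p = 0 then 1 else 0) \<in> W" .
    have "dih_plane z refl *\<^sub>v vec 2 (\<lambda>p. if p = 0 then 1 else 0) \<in> W" by (rule W(6)[OF e0])
    also have "dih_plane z refl *\<^sub>v vec 2 (\<lambda>p. if p = 0 then 1 else 0) = vec 2 (\<lambda>p. if p = 0 then 0 else 1)"
      by (subst refl) (auto intro!: eq_vecI)
    finally have e1: "vec 2 (\<lambda>p. if p = 0 then 0 else 1) \<in> W" .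
    have "v \<in> W" if "v \<in> carrier_vec 2" for v
    proof -
      have "v = v $ 0 \<cdot>\<^sub>v vec 2 (\<lambda>p. if p = 0 then 1 else 0) + v $ 1 \<cdot>\<^sub>v vec 2 (\<lambda>p. if p = 0 then 0 else 1)"
        using that by (intro eq_vecI) (auto simp: less_2_cases_iff)
      thus ?thesis using W(3)[OF W(4)[OF e0] W(4)[OF e1]] by metis
    qed
    thus ?thesis using W(1) by blast
  qed
  thus "W = {0\<^sub>v (cg_dim D (dih_plane z))} \<or> W = carrier_vec (cg_dim D (dih_plane z))" by auto
qed simp

section \<open>Products with the modules of dimension one and two\<close>

text \<open>
  The reflection exchanges the two basis vectors of the plane; their sum and difference span its
  two invariant lines when the rotation acts as a sign.
\<close>

lemma rep_eq_dih_char_pair: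
  assumes "x ^ n = 1" "x * x = 1" "e * e = 1"
  shows "rep_eq D (frag_of (dih_char x e) + frag_of (dih_char x (- e))) (frag_of (dih_plane x))"
proof -
  have X: "cg_module D (dih_char x e)" "cg_module D (dih_char x (- e))" "cg_module D (dih_plane x)"
    using assms by (auto intro: cg_module_dih_char cg_module_dih_plane)
  have inv: "inverse x = x" using assms(2) by (rule inverse_unique)
  let ?P = "mat 2 2 (\<lambda>(i, j). if i = 0 then 1 else if j = 0 then e else - e)"
  let ?Q = "mat 2 2 (\<lambda>(i, j). if j = 0 then 1 / 2 else if i = 0 then e / 2 else - e / 2)"
  have "rep_eq D (frag_of (cg_sum (dih_char x e) (dih_char x (- e)))) (frag_of (dih_plane x))"
  proof (rule rep_eq_by_generators[where P = ?P and Q = ?Q and d = 2])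
    show "?P * ?Q = 1\<^sub>m 2"
      using assms(3) by (intro eq_matI) (auto simp: scalar_prod_def numeral_2_eq_2 less_Suc_eq)
    show "?P * cg_sum (dih_char x e) (dih_char x (- e)) rot = dih_plane x rot * ?P"
      by (intro eq_matI)
        (auto simp: scalar_prod_def numeral_2_eq_2 less_Suc_eq cg_sum_apply dih_char_rot[OF assms(1)] dih_plane_rot[OF assms(1)] inv)
    show "?P * cg_sum (dih_char x e) (dih_char x (- e)) refl = dih_plane x refl * ?P"
      using assms(3) by (intro eq_matI)
        (auto simp: scalar_prod_def numeral_2_eq_2 less_Suc_eq cg_sum_apply dih_char_refl dih_plane_refl)
  qed (use X in \<open>auto intro: cg_module_sum\<close>)
  thus ?thesis using rep_eq_trans[OF rep_eq_sym[OF rep_eq_cg_sum[OF X(1,2)]]] by blast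
qed

lemma tensor_dih_char_dih_char: "cg_tensor (dih_char c e) (dih_char d f) = dih_char (c * d) (e * f)"
  by (rule ext) (auto simp: cg_tensor_def kronecker_def dih_char_def power_int_mult_distrib intro!: eq_matI)

lemma rep_eq_tensor_dih_char_dih_plane:
  assumes c: "c ^ n = 1" "c * c = 1" "e * e = 1" and z: "z ^ n = 1"
  shows "rep_eq D (frag_of (cg_tensor (dih_char c e) (dih_plane z))) (frag_of (dih_plane (c * z)))"
proof -
  have inv: "inverse c = c" using c(2) by (rule inverse_unique)
  have cz: "(c * z) ^ n = 1" using c z by (simp add: power_mult_distrib)
  let ?P = "mat 2 2 (\<lambda>(i, j). if i \<noteq> j then 0 else if i = 0 then 1 else e)"
  show ?thesis
  proof (rule rep_eq_by_generators[where P = ?P and Q = ?P and d = 2])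
    show "?P * ?P = 1\<^sub>m 2"
      using c(3) by (intro eq_matI) (auto simp: scalar_prod_def numeral_2_eq_2 less_Suc_eq)
    show "?P * cg_tensor (dih_char c e) (dih_plane z) rot = dih_plane (c * z) rot * ?P"
      by (intro eq_matI) (auto simp: scalar_prod_def numeral_2_eq_2 less_Suc_eq cg_tensor_def kronecker_def
         dih_char_rot[OF c(1)] dih_plane_rot[OF z] dih_plane_rot[OF cz] inv)
    show "?P * cg_tensor (dih_char c e) (dih_plane z) refl = dih_plane (c * z) refl * ?P"
      using c(3) by (intro eq_matI) (auto simp: scalar_prod_def numeral_2_eq_2 less_Suc_eq cg_tensor_def kronecker_def
         dih_char_refl dih_plane_refl)
  qed (use assms cz in \<open>auto intro!: cg_module_tensor cg_module_dih_char cg_module_dih_plane\<close>)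
qed

lemma rep_eq_tensor_dih_plane_dih_char:
  assumes x: "x ^ n = 1" and c: "c ^ n = 1" "c * c = 1"
  shows "rep_eq D (frag_of (cg_tensor (dih_plane x) (dih_char c 1))) (frag_of (dih_plane (x * c)))"
proof -
  have inv: "inverse c = c" using c(2) by (rule inverse_unique)
  have xc: "(x * c) ^ n = 1" using c x by (simp add: power_mult_distrib)
  show ?thesis
  proof (rule rep_eq_by_generators[where P = "1\<^sub>m 2" and Q = "1\<^sub>m 2" and d = 2])
    show "1\<^sub>m 2 * cg_tensor (dih_plane x) (dih_char c 1) rot = dih_plane (x * c) rot * 1\<^sub>m 2"
      by (intro eq_matI) (auto simp: scalar_prod_def numeral_2_eq_2 less_Suc_eq cg_tensor_def kronecker_def
         dih_char_rot[OF c(1)] dih_plane_rot[OF x] dih_plane_rot[OF xc] inv)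
    show "1\<^sub>m 2 * cg_tensor (dih_plane x) (dih_char c 1) refl = dih_plane (x * c) refl * 1\<^sub>m 2"
      by (intro eq_matI) (auto simp: scalar_prod_def numeral_2_eq_2 less_Suc_eq cg_tensor_def kronecker_def
         dih_char_refl dih_plane_refl)
  qed (use assms xc in \<open>auto intro!: cg_module_tensor cg_module_dih_char cg_module_dih_plane\<close>)
qed

text \<open>
  The rotation has the eigenvalues $xz, x/z, z/x, 1/(xz)$ on the four products of basis vectors, and
  the reflection exchanges the first with the last and the two middle ones. So the isomorphism only
  permutes the basis.
\<close>

lemma rep_eq_tensor_dih_plane_dih_plane:
  assumes x: "x ^ n = 1" and z: "z ^ n = 1"
  shows "rep_eq D (frag_of (cg_tensor (dih_plane x) (dih_plane z)))
           (frag_of (dih_plane (x * z)) + frag_of (dih_plane (x * inverse z)))"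
proof -
  have xz: "(x * z) ^ n = 1" "(x * inverse z) ^ n = 1"
    using x z by (auto simp: power_mult_distrib power_inverse)
  note mods = cg_module_dih_plane[OF xz(1)] cg_module_dih_plane[OF xz(2)]
  \<comment> \<open>\<open>?P\<close> sends the products 00, 11, 01, 10 of basis vectors to positions 0, 1, 2, 3.\<close>
  let ?P = "mat 4 4 (\<lambda>(i, j). if (i, j) \<in> {(0, 0), (1, 3), (2, 1), (3, 2)} then 1 else (0::complex))"
  let ?Q = "mat 4 4 (\<lambda>(j, i). if (i, j) \<in> {(0, 0), (1, 3), (2, 1), (3, 2)} then 1 else (0::complex))"
  have four: "i < 4 \<longleftrightarrow> i = 0 \<or> i = 1 \<or> i = 2 \<or> i = 3" for i :: nat by auto
  have sum4: "(\<Sum>k = 0..<4. f k) = f 0 + f 1 + f 2 + f 3" for f :: "nat \<Rightarrow> complex"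
    by (simp add: eval_nat_numeral)
  have "rep_eq D (frag_of (cg_tensor (dih_plane x) (dih_plane z)))
          (frag_of (cg_sum (dih_plane (x * z)) (dih_plane (x * inverse z))))"
  proof (rule rep_eq_by_generators[where P = ?P and Q = ?Q and d = 4])
    show "?P * ?Q = 1\<^sub>m 4"
      by (intro eq_matI) (auto simp: scalar_prod_def four sum4)
    show "?P * cg_tensor (dih_plane x) (dih_plane z) rot =
        cg_sum (dih_plane (x * z)) (dih_plane (x * inverse z)) rot * ?P"
      by (intro eq_matI) (auto simp: scalar_prod_def four sum4 cg_tensor_def kronecker_def cg_sum_apply
         dih_plane_rot[OF x] dih_plane_rot[OF z] dih_plane_rot[OF xz(1)] dih_plane_rot[OF xz(2)])
    show "?P * cg_tensor (dih_plane x) (dih_plane z) refl =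
        cg_sum (dih_plane (x * z)) (dih_plane (x * inverse z)) refl * ?P"
      by (intro eq_matI) (auto simp: scalar_prod_def four sum4 cg_tensor_def kronecker_def cg_sum_apply dih_plane_refl)
  qed (use assms xz in \<open>auto intro!: cg_module_tensor cg_module_sum cg_module_dih_plane\<close>)
  thus ?thesis using rep_eq_trans[OF _ rep_eq_cg_sum[OF mods]] by blast
qed

section \<open>The regular module\<close>

lemma regular_module_alt:
  obtains e where "bij_betw e {..<2 * n} (carrier D)"
    "regular_module D = (\<lambda>g. mat (2 * n) (2 * n) (\<lambda>(i, j). if e i = g \<otimes>\<^bsub>D\<^esub> e j then 1 else 0))"
proof
  let ?e = "SOME e. bij_betw e {..<Coset.order D} (carrier D)"
  have "finite (carrier D)" by (simp add: carrier_D)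
  hence "\<exists>e. bij_betw e {..<Coset.order D} (carrier D)"
    using ex_bij_betw_nat_finite[of "carrier D"] by (simp add: Coset.order_def atLeast0LessThan)
  from someI_ex[OF this] show "bij_betw ?e {..<2 * n} (carrier D)"
    by (simp add: order_dihedral_group)
  show "regular_module D = (\<lambda>g. mat (2 * n) (2 * n) (\<lambda>(i, j). if ?e i = g \<otimes>\<^bsub>D\<^esub> ?e j then 1 else 0))"
    by (simp add: regular_module_def order_dihedral_group Let_def)
qed

text \<open>
  The direct sum of the planes with parameters $zs_0, \dots, zs_{m-1}$, by an explicit formula for its
  entries so that the product with the Fourier matrix can be computed.
\<close>

definition plane_sum :: "(nat \<Rightarrow> complex) \<Rightarrow> nat \<Rightarrow> (int \<times> bool) cg_mod" where
  "plane_sum zs m = (\<lambda>g. mat (2 * m) (2 * m) (\<lambda>(i, j).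
     if i div 2 = j div 2 then dih_plane (zs (i div 2)) g $$ (i mod 2, j mod 2) else 0))"

lemma cg_dim_plane_sum [simp]: "cg_dim D (plane_sum zs m) = 2 * m"
  by (simp add: cg_dim_def plane_sum_def)

lemma dih_plane_dims [simp]: "dim_row (dih_plane z g) = 2" "dim_col (dih_plane z g) = 2"
  by (auto simp: dih_plane_def split: prod.split)

lemma plane_sum_Suc: "plane_sum zs (Suc m) = cg_sum (plane_sum zs m) (dih_plane (zs m))"
proof (rule ext, rule eq_matI)
  fix g i j
  assume "i < dim_row (cg_sum (plane_sum zs m) (dih_plane (zs m)) g)"
    "j < dim_col (cg_sum (plane_sum zs m) (dih_plane (zs m)) g)"
  hence ij: "i < 2 * m + 2" "j < 2 * m + 2" by (auto simp: cg_sum_apply plane_sum_def)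
  have low: "k div 2 < m" if "k < 2 * m" for k :: nat
    using that by presburger
  have high: "k div 2 = m" "k mod 2 = k - 2 * m" if "k < 2 * m + 2" "\<not> k < 2 * m" for k :: nat
    using that by presburger+
  show "plane_sum zs (Suc m) g $$ (i, j) = cg_sum (plane_sum zs m) (dih_plane (zs m)) g $$ (i, j)"
  proof (cases "i < 2 * m"; cases "j < 2 * m")
    assume "i < 2 * m" "j < 2 * m"
    thus ?thesis by (simp add: cg_sum_apply plane_sum_def)
  next
    assume *: "i < 2 * m" "\<not> j < 2 * m"
    thus ?thesis using ij low[OF *(1)] high(1)[OF ij(2) *(2)] by (simp add: cg_sum_apply plane_sum_def)
  next
    assume *: "\<not> i < 2 * m" "j < 2 * m"
    thus ?thesis using ij low[OF *(2)] high(1)[OF ij(1) *(1)] by (simp add: cg_sum_apply plane_sum_def)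
  next
    assume *: "\<not> i < 2 * m" "\<not> j < 2 * m"
    thus ?thesis using ij high[OF ij(1) *(1)] high[OF ij(2) *(2)] by (simp add: cg_sum_apply plane_sum_def)
  qed
qed (auto simp: cg_sum_apply plane_sum_def)

lemma plane_sum_decomposition:
  assumes "\<And>k. k < m \<Longrightarrow> zs k ^ n = 1"
  shows "cg_module D (plane_sum zs m) \<and>
    rep_eq D (frag_of (plane_sum zs m)) (\<Sum>k<m. frag_of (dih_plane (zs k)))"
  using assms
proof (induction m)
  case 0
  have "cg_module D (plane_sum zs 0)"
    by (rule cg_moduleI[where d = 0]) (auto simp: plane_sum_def intro!: eq_matI)
  thus ?case by (simp add: rep_eq_zero_dim)
next
  case (Suc m)
  hence IH: "cg_module D (plane_sum zs m)"
    "rep_eq D (frag_of (plane_sum zs m)) (\<Sum>k<m. frag_of (dih_plane (zs k)))" by auto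
  have V: "cg_module D (dih_plane (zs m))" using Suc.prems by (intro cg_module_dih_plane) auto
  have "rep_eq D (frag_of (plane_sum zs (Suc m))) (frag_of (plane_sum zs m) + frag_of (dih_plane (zs m)))"
    unfolding plane_sum_Suc by (rule rep_eq_cg_sum[OF IH(1) V])
  also have "rep_eq D \<dots> ((\<Sum>k<m. frag_of (dih_plane (zs k))) + frag_of (dih_plane (zs m)))"
    by (rule rep_eq_add[OF IH(2) rep_eq_refl])
  finally show ?case using cg_module_sum[OF IH(1) V] by (simp add: plane_sum_Suc)
qed

text \<open>
  These are the orthogonality relations between matrix coefficients in the first columns of two
  planes. A coefficient in row 0 vanishes on reflections and one in row 1 on rotations, so different
  rows never meet, and equal rows give a geometric sum of the powers of $x/y$ or $y/x$.
\<close>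

lemma dih_plane_orthogonality:
  assumes x: "x ^ n = 1" and y: "y ^ n = 1" and b: "b < 2" "b' < 2"
  shows "(\<Sum>h\<in>carrier D. dih_plane x h $$ (b, 0) * dih_plane (inverse y) h $$ (b', 0)) =
    (if x = y \<and> b = b' then of_nat n else 0)"
proof -
  have geo: "(\<Sum>i\<in>{0..<int n}. t powi i) = (if t = 1 then of_nat n else 0)" if "t ^ n = 1" for t :: complex
  proof -
    have "(\<Sum>i\<in>{0..<int n}. t powi i) = (\<Sum>k<n. t ^ k)"
      by (rule sum.reindex_bij_witness[where i = int and j = nat]) (auto simp: power_int_nonneg_exp)
    also have "\<dots> = (if t = 1 then of_nat n else 0)"
      using that by (simp add: sum_gp_strict)
    finally show ?thesis .
  qed
  have x0: "x \<noteq> 0" and y0: "y \<noteq> 0" using root_nonzero x y by auto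
  have xy: "(x / y) ^ n = 1" "(y / x) ^ n = 1" using x y by (simp_all add: power_divide)
  have iff: "x / y = 1 \<longleftrightarrow> x = y" "y / x = 1 \<longleftrightarrow> x = y" using x0 y0 by auto
  have pw: "x powi i * inverse y powi i = (x / y) powi i"
     "x powi - i * inverse y powi - i = (y / x) powi i"
     "(x / y) powi - i = (y / x) powi i" for i
    using x0 y0 by (simp_all add: power_int_divide_distrib power_int_inverse power_int_minus divide_inverse power_int_mult_distrib)
  have "(\<Sum>h\<in>carrier D. dih_plane x h $$ (b, 0) * dih_plane (inverse y) h $$ (b', 0)) =
     (\<Sum>i\<in>{0..<int n}. \<Sum>a\<in>UNIV. dih_plane x (i, a) $$ (b, 0) * dih_plane (inverse y) (i, a) $$ (b', 0))"
    by (simp add: carrier_D sum.cartesian_product)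
  also have "\<dots> = (\<Sum>i\<in>{0..<int n}. if b \<noteq> b' then 0 else if b = 0 then (x / y) powi i else (y / x) powi i)"
    using b by (intro sum.cong refl) (auto simp: UNIV_bool dih_plane_def less_2_cases_iff pw)
  also have "\<dots> = (if x = y \<and> b = b' then of_nat n else 0)"
    using geo[OF xy(1)] geo[OF xy(2)] unfolding iff by (cases "b = b'"; cases "b = 0") auto
  finally show ?thesis .
qed

lemma cg_module_regular: "cg_module D (regular_module D)"
proof -
  obtain e where e: "bij_betw e {..<2 * n} (carrier D)"
    and reg: "regular_module D = (\<lambda>g. mat (2 * n) (2 * n) (\<lambda>(i, j). if e i = g \<otimes>\<^bsub>D\<^esub> e j then 1 else 0))"
    by (rule regular_module_alt)
  interpret group D using n_pos by (rule group_dihedral_group)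
  have ecar: "e j \<in> carrier D" if "j < 2 * n" for j
    using e that by (auto simp: bij_betw_def)
  have einj: "e i = e j \<longleftrightarrow> i = j" if "i < 2 * n" "j < 2 * n" for i j
    using e that by (auto simp: bij_betw_def inj_on_def)
  show ?thesis
  proof (rule cg_moduleI[where d = "2 * n"])
    fix g h assume g: "g \<in> carrier D" and h: "h \<in> carrier D"
    show "regular_module D (g \<otimes>\<^bsub>D\<^esub> h) = regular_module D g * regular_module D h"
    proof (rule eq_matI)
      fix i j assume "i < dim_row (regular_module D g * regular_module D h)"
        "j < dim_col (regular_module D g * regular_module D h)"
      hence ij: "i < 2 * n" "j < 2 * n" by (auto simp: reg)
      have "h \<otimes>\<^bsub>D\<^esub> e j \<in> e ` {..<2 * n}" using e h ecar[OF ij(2)] by (auto simp: bij_betw_def)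
      then obtain k where k: "k < 2 * n" "e k = h \<otimes>\<^bsub>D\<^esub> e j" by auto
      have "(regular_module D g * regular_module D h) $$ (i, j) =
          (\<Sum>l<2 * n. (if e i = g \<otimes>\<^bsub>D\<^esub> e l then 1 else 0) * (if l = k then 1 else 0))"
        using ij by (auto simp: reg scalar_prod_def lessThan_atLeast0 k(2)[symmetric] einj k(1) intro!: sum.cong)
      also have "\<dots> = (if e i = g \<otimes>\<^bsub>D\<^esub> e k then 1 else 0)"
        using k(1) by (subst sum_mult_indicator) auto
      also have "\<dots> = regular_module D (g \<otimes>\<^bsub>D\<^esub> h) $$ (i, j)"
        using ij g h ecar[OF ij(2)] by (simp add: reg k(2) m_assoc)
      finally show "regular_module D (g \<otimes>\<^bsub>D\<^esub> h) $$ (i, j) =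
        (regular_module D g * regular_module D h) $$ (i, j)" by simp
    qed (auto simp: reg)
  next
    show "regular_module D \<one>\<^bsub>D\<^esub> = 1\<^sub>m (2 * n)"
      by (intro eq_matI) (auto simp: reg ecar einj)
  qed (auto simp: reg)
qed

text \<open>
  A nonabelian Fourier transform: the basis vector of \<open>h\<close> is sent to the image under \<open>h\<close> of the
  vector that has the first basis vector as component in each plane. This commutes with the action by
  construction, and it is invertible by the orthogonality relations.
\<close>

lemma cg_iso_regular:
  assumes zs: "\<And>k. k < n \<Longrightarrow> zs k ^ n = 1" and inj: "inj_on zs {..<n}"
  shows "cg_iso D (regular_module D) (plane_sum zs n)"
proof -
  obtain e where e: "bij_betw e {..<2 * n} (carrier D)"
    and reg: "regular_module D = (\<lambda>g. mat (2 * n) (2 * n) (\<lambda>(i, j). if e i = g \<otimes>\<^bsub>D\<^esub> e j then 1 else 0))"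
    by (rule regular_module_alt)
  interpret group D using n_pos by (rule group_dihedral_group)
  have ecar: "e j \<in> carrier D" if "j < 2 * n" for j
    using e that by (auto simp: bij_betw_def)
  have einj: "e i = e j \<longleftrightarrow> i = j" if "i < 2 * n" "j < 2 * n" for i j
    using e that by (auto simp: bij_betw_def inj_on_def)
  define P where "P = mat (2 * n) (2 * n) (\<lambda>(l, j). dih_plane (zs (l div 2)) (e j) $$ (l mod 2, 0))"
  define Q where "Q = mat (2 * n) (2 * n) (\<lambda>(j, l). dih_plane (inverse (zs (l div 2))) (e j) $$ (l mod 2, 0) / of_nat n)"
  show ?thesis
  proof (rule cg_isoI[where P = P and Q = Q and d = "2 * n"])
    show "P * Q = 1\<^sub>m (2 * n)"
    proof (rule eq_matI)
      fix l m assume "l < dim_row (1\<^sub>m (2 * n))" "m < dim_col (1\<^sub>m (2 * n))"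
      hence lm: "l < 2 * n" "m < 2 * n" by auto
      hence half: "l div 2 < n" "m div 2 < n" by auto
      have "(P * Q) $$ (l, m) = (\<Sum>j<2 * n. dih_plane (zs (l div 2)) (e j) $$ (l mod 2, 0) *
          dih_plane (inverse (zs (m div 2))) (e j) $$ (m mod 2, 0)) / of_nat n"
        using lm by (simp add: P_def Q_def scalar_prod_def lessThan_atLeast0 sum_divide_distrib)
      also have "(\<Sum>j<2 * n. dih_plane (zs (l div 2)) (e j) $$ (l mod 2, 0) *
          dih_plane (inverse (zs (m div 2))) (e j) $$ (m mod 2, 0)) =
          (\<Sum>h\<in>carrier D. dih_plane (zs (l div 2)) h $$ (l mod 2, 0) *
          dih_plane (inverse (zs (m div 2))) h $$ (m mod 2, 0))"
        by (rule sum.reindex_bij_betw[OF e])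
      also have "\<dots> = (if zs (l div 2) = zs (m div 2) \<and> l mod 2 = m mod 2 then of_nat n else 0)"
        by (rule dih_plane_orthogonality[OF zs[OF half(1)] zs[OF half(2)]]) auto
      also have "zs (l div 2) = zs (m div 2) \<and> l mod 2 = m mod 2 \<longleftrightarrow> l = m"
      proof -
        have "zs (l div 2) = zs (m div 2) \<longleftrightarrow> l div 2 = m div 2"
          using inj_on_eq_iff[OF inj] half by simp
        moreover have "l = m \<longleftrightarrow> l div 2 = m div 2 \<and> l mod 2 = m mod 2"
          using div_mult_mod_eq[of l 2] div_mult_mod_eq[of m 2] by metis
        ultimately show ?thesis by simp
      qed
      finally show "(P * Q) $$ (l, m) = 1\<^sub>m (2 * n) $$ (l, m)"
        using lm n_pos by simp
    qed (auto simp: P_def Q_def)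
  next
    fix g assume g: "g \<in> carrier D"
    show "P * regular_module D g = plane_sum zs n g * P"
    proof (rule eq_matI)
      fix l j assume "l < dim_row (plane_sum zs n g * P)" "j < dim_col (plane_sum zs n g * P)"
      hence lj: "l < 2 * n" "j < 2 * n" by (auto simp: plane_sum_def P_def)
      hence half: "l div 2 < n" by auto
      let ?V = "dih_plane (zs (l div 2))"
      have V: "cg_module D ?V" using zs[OF half] by (rule cg_module_dih_plane)
      have "g \<otimes>\<^bsub>D\<^esub> e j \<in> e ` {..<2 * n}" using e g ecar[OF lj(2)] by (auto simp: bij_betw_def)
      then obtain k where k: "k < 2 * n" "e k = g \<otimes>\<^bsub>D\<^esub> e j" by auto
      have "(P * regular_module D g) $$ (l, j) =
          (\<Sum>m<2 * n. ?V (e m) $$ (l mod 2, 0) * (if m = k then 1 else 0))"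
        using lj by (auto simp: P_def reg scalar_prod_def lessThan_atLeast0 k(2)[symmetric] einj k(1) intro!: sum.cong)
      also have "\<dots> = ?V (g \<otimes>\<^bsub>D\<^esub> e j) $$ (l mod 2, 0)"
        using k by (subst sum_mult_indicator) auto
      also have "\<dots> = (?V g * ?V (e j)) $$ (l mod 2, 0)"
        by (simp only: cg_module_mult[OF V g ecar[OF lj(2)]])
      also have "\<dots> = (\<Sum>b<2. ?V g $$ (l mod 2, b) * ?V (e j) $$ (b, 0))"
        by (simp add: scalar_prod_def lessThan_atLeast0)
      also have "\<dots> = (\<Sum>i<n. if l div 2 = i then \<Sum>b<2. ?V g $$ (l mod 2, b) * dih_plane (zs i) (e j) $$ (b, 0) else 0)"
        using half by (simp add: sum.delta')
      also have "\<dots> = (\<Sum>i<n. \<Sum>b<2. (if l div 2 = i then ?V g $$ (l mod 2, b) else 0) * dih_plane (zs i) (e j) $$ (b, 0))"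
        by (intro sum.cong refl) auto
      also have "\<dots> = (\<Sum>m<n * 2. (if l div 2 = m div 2 then ?V g $$ (l mod 2, m mod 2) else 0) *
          dih_plane (zs (m div 2)) (e j) $$ (m mod 2, 0))"
        by (rule sum_div_mod[symmetric, where f = "\<lambda>i b. (if l div 2 = i then ?V g $$ (l mod 2, b) else 0) *
              dih_plane (zs i) (e j) $$ (b, 0)"])
      also have "\<dots> = (plane_sum zs n g * P) $$ (l, j)"
        using lj by (simp add: plane_sum_def P_def scalar_prod_def lessThan_atLeast0 mult.commute[of n 2])
      finally show "(P * regular_module D g) $$ (l, j) = (plane_sum zs n g * P) $$ (l, j)" .
    qed (auto simp: P_def reg plane_sum_def)
  qed (auto simp: P_def Q_def reg cg_dim_def plane_sum_def)
qed

lemma regular_decomposition: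
  "rep_eq D (\<Sum>z | z ^ n = 1. frag_of (dih_plane z)) (frag_of (regular_module D))"
proof -
  define zs where "zs = (\<lambda>k. cis (2 * pi * real k / real n))"
  have bij: "bij_betw zs {..<n} {z. z ^ n = 1}"
    unfolding zs_def using n_pos by (intro bij_betw_roots_unity) auto
  have zs: "zs k ^ n = 1" if "k < n" for k
    using bij that by (auto simp: bij_betw_def)
  have "rep_eq D (frag_of (regular_module D)) (frag_of (plane_sum zs n))"
    using plane_sum_decomposition[of n zs, OF zs] bij_betw_imp_inj_on[OF bij]
    by (intro rep_eq_iso cg_module_regular cg_iso_regular zs) blast+
  also have "rep_eq D \<dots> (\<Sum>k<n. frag_of (dih_plane (zs k)))"
    using plane_sum_decomposition[of n zs, OF zs] by blast
  also have "(\<Sum>k<n. frag_of (dih_plane (zs k))) = (\<Sum>z | z ^ n = 1. frag_of (dih_plane z))"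
    by (rule sum.reindex_bij_betw[OF bij])
  finally show ?thesis by (rule rep_eq_sym)
qed

section \<open>Classification of the simple modules\<close>

text \<open>
  Let \<open>v\<close> be an eigenvector of the rotation, with eigenvalue \<open>z\<close>, and \<open>w\<close> its image under the
  reflection. Then \<open>w\<close> is an eigenvector for $z^{-1}$, so \<open>v\<close> and \<open>w\<close> define a homomorphism from
  the plane of \<open>z\<close> to \<open>M\<close>, and it is onto because its image is a nonzero submodule. Hence the dimension
  is at most two; in dimension two the homomorphism is an isomorphism, and in dimension one the
  relations of the group force both generators to act as signs.
\<close>

lemma simple_module_cases:
  assumes M: "cg_simple D M"
  obtains c e where "c ^ n = 1" "c * c = 1" "e * e = 1" "cg_iso D (dih_char c e) M"
  | z where "z ^ n = 1" "cg_iso D (dih_plane z) M"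
proof -
  define d where "d = cg_dim D M"
  define A where "A = M rot"
  define B where "B = M refl"
  have mod: "cg_module D M" and d0: "d > 0" using M by (auto simp: cg_simple_def d_def)
  have A: "A \<in> carrier_mat d d" and B: "B \<in> carrier_mat d d"
    unfolding A_def B_def d_def by (intro cg_module_carrier[OF mod] rot_refl_D)+
  have AnB: "A ^\<^sub>m n = 1\<^sub>m d" "B * B = 1\<^sub>m d" "A * (B * A) = B"
  proof -
    have "A ^\<^sub>m k = M (int k mod int n, False)" for k
    proof (induction k)
      case 0
      show ?case using cg_module_one[OF mod] A by (simp add: one_D d_def)
    next
      case (Suc k)
      have k: "(int k mod int n, False) \<in> carrier D" using n_pos by (simp add: carrier_D)
      have "A ^\<^sub>m Suc k = M (int k mod int n, False) * M rot" using Suc by (simp add: A_def)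
      also have "\<dots> = M ((int k mod int n, False) \<otimes>\<^bsub>D\<^esub> rot)"
        by (rule cg_module_mult[OF mod k rot_refl_D(1), symmetric])
      also have "(int k mod int n, False) \<otimes>\<^bsub>D\<^esub> rot = (int (Suc k) mod int n, False)"
        by (simp add: mult_D mod_simps add.commute)
      finally show ?case .
    qed
    from this[of n] show "A ^\<^sub>m n = 1\<^sub>m d" using cg_module_one[OF mod] by (simp add: one_D d_def)
    have "B * B = M (refl \<otimes>\<^bsub>D\<^esub> refl)"
      unfolding B_def by (rule cg_module_mult[OF mod rot_refl_D(2) rot_refl_D(2), symmetric])
    also have "refl \<otimes>\<^bsub>D\<^esub> refl = \<one>\<^bsub>D\<^esub>" by (simp add: mult_D one_D)
    finally show "B * B = 1\<^sub>m d" by (simp add: cg_module_one[OF mod] d_def)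
    have sr: "refl \<otimes>\<^bsub>D\<^esub> rot \<in> carrier D" using n_pos by (simp add: mult_D carrier_D)
    have "A * (B * A) = M rot * M (refl \<otimes>\<^bsub>D\<^esub> rot)"
      unfolding A_def B_def by (simp only: cg_module_mult[OF mod rot_refl_D(2) rot_refl_D(1)])
    also have "\<dots> = M (rot \<otimes>\<^bsub>D\<^esub> (refl \<otimes>\<^bsub>D\<^esub> rot))"
      by (rule cg_module_mult[OF mod rot_refl_D(1) sr, symmetric])
    also have "rot \<otimes>\<^bsub>D\<^esub> (refl \<otimes>\<^bsub>D\<^esub> rot) = refl" by (simp add: mult_D mod_simps)
    finally show "A * (B * A) = B" by (simp add: B_def)
  qed
  obtain z where "eigenvalue A z" using spectrum_non_empty[OF A d0] by (auto simp: spectrum_def)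
  then obtain v where ev: "eigenvector A v z" by (auto simp: eigenvalue_def)
  hence v: "v \<in> carrier_vec d" "v \<noteq> 0\<^sub>v d" "A *\<^sub>v v = z \<cdot>\<^sub>v v"
    using A by (auto simp: eigenvector_def)
  have "\<exists>i<d. v $ i \<noteq> 0"
  proof (rule ccontr)
    assume "\<not> (\<exists>i<d. v $ i \<noteq> 0)"
    hence "v = 0\<^sub>v d" using v(1) by (intro eq_vecI) auto
    thus False using v(2) by simp
  qed
  then obtain i0 where i0: "i0 < d" "v $ i0 \<noteq> 0" by blast
  have "v = z ^ n \<cdot>\<^sub>v v" using eigenvector_pow[OF A ev, of n] v(1) by (simp add: AnB)
  hence "v $ i0 = z ^ n * v $ i0" using i0(1) v(1) by (subst (asm) vec_eq_iff) simp
  hence zn: "z ^ n = 1" using i0(2) by simp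
  have z0: "z \<noteq> 0" by (rule root_nonzero[OF zn])
  define w where "w = B *\<^sub>v v"
  have w: "w \<in> carrier_vec d" using B v(1) by (simp add: w_def)
  have Bw: "B *\<^sub>v w = v" unfolding w_def using assoc_mult_mat_vec[OF B B v(1)] v(1) by (simp add: AnB)
  \<comment> \<open>The relation \<open>r s r = s\<close> turns the eigenvalue \<open>z\<close> of \<open>v\<close> into the eigenvalue $z^{-1}$ of \<open>w\<close>.\<close>
  have "w = A *\<^sub>v (B *\<^sub>v (A *\<^sub>v v))"
    using assoc_mult_mat_vec[OF A mult_carrier_mat[OF B A] v(1)] assoc_mult_mat_vec[OF B A v(1)]
    by (simp add: AnB(3) w_def)
  also have "\<dots> = z \<cdot>\<^sub>v (A *\<^sub>v w)"
    unfolding v(3) using A B v(1) by (simp add: w_def mult_mat_vec)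
  finally have zAw: "z \<cdot>\<^sub>v (A *\<^sub>v w) = w" ..
  have Aw: "A *\<^sub>v w = inverse z \<cdot>\<^sub>v w"
  proof -
    have "A *\<^sub>v w = inverse z \<cdot>\<^sub>v (z \<cdot>\<^sub>v (A *\<^sub>v w))" using z0 by (simp add: smult_smult_assoc)
    thus ?thesis by (simp only: zAw)
  qed

  define P where "P = mat d 2 (\<lambda>(i, j). if j = 0 then v $ i else w $ i)"
  have P: "P \<in> carrier_mat d 2" by (simp add: P_def)
  have colP: "col P 0 = v" "col P 1 = w" using v(1) w by (auto simp: P_def intro!: eq_vecI)
  have V: "cg_module D (dih_plane z)" by (rule cg_module_dih_plane[OF zn])
  have AP: "(C * P) $$ (i, j) = (C *\<^sub>v (if j = 0 then v else w)) $ i" if "i < d" "j < 2" "C \<in> carrier_mat d d" for C i j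
    using that P colP by (auto simp: less_2_cases_iff)
  have inter: "P * dih_plane z g = M g * P" if g: "g \<in> carrier D" for g
  proof (rule intertwine_generators[OF V mod _ _ _ g])
    show "P * dih_plane z rot = M rot * P"
    proof (rule eq_matI)
      fix i j assume "i < dim_row (M rot * P)" "j < dim_col (M rot * P)"
      hence ij: "i < d" "j < 2" using A P by (auto simp: A_def)
      show "(P * dih_plane z rot) $$ (i, j) = (M rot * P) $$ (i, j)"
        unfolding A_def[symmetric] AP[OF ij A] using ij v w
        by (auto simp: less_2_cases_iff Aw dih_plane_rot[OF zn] P_def scalar_prod_def numeral_2_eq_2)
    qed (use A P in \<open>auto simp: A_def\<close>)
    show "P * dih_plane z refl = M refl * P"
    proof (rule eq_matI)
      fix i j assume "i < dim_row (M refl * P)" "j < dim_col (M refl * P)"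
      hence ij: "i < d" "j < 2" using B P by (auto simp: B_def)
      show "(P * dih_plane z refl) $$ (i, j) = (M refl * P) $$ (i, j)"
        unfolding B_def[symmetric] AP[OF ij B] using ij v(1) w
        by (auto simp: less_2_cases_iff Bw w_def[symmetric] dih_plane_refl P_def scalar_prod_def numeral_2_eq_2)
    qed (use B P in \<open>auto simp: B_def\<close>)
  qed (use P in \<open>simp add: d_def\<close>)

  define W where "W = (\<lambda>x. P *\<^sub>v x) ` carrier_vec 2"
  have "cg_submodule D M W"
    unfolding cg_submodule_iff d_def[symmetric]
  proof (intro conjI ballI allI)
    show "W \<subseteq> carrier_vec d" using P by (auto simp: W_def)
    have "P *\<^sub>v 0\<^sub>v 2 = 0\<^sub>v d" using P by (intro eq_vecI) (auto simp: scalar_prod_def)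
    thus "0\<^sub>v d \<in> W" unfolding W_def by (metis imageI zero_carrier_vec)
  next
    fix x y assume "x \<in> W" "y \<in> W"
    then obtain x' y' where "x = P *\<^sub>v x'" "y = P *\<^sub>v y'" "x' \<in> carrier_vec 2" "y' \<in> carrier_vec 2"
      by (auto simp: W_def)
    thus "x + y \<in> W" unfolding W_def using mult_add_distrib_mat_vec[OF P, of x' y']
      by (intro image_eqI[where x = "x' + y'"]) auto
  next
    fix k x assume "x \<in> W"
    then obtain x' where "x = P *\<^sub>v x'" "x' \<in> carrier_vec 2" by (auto simp: W_def)
    thus "k \<cdot>\<^sub>v x \<in> W" unfolding W_def using mult_mat_vec[OF P, of x' k]
      by (intro image_eqI[where x = "k \<cdot>\<^sub>v x'"]) auto
  next
    fix g x assume g: "g \<in> carrier D" and "x \<in> W"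
    then obtain x' where x: "x = P *\<^sub>v x'" "x' \<in> carrier_vec 2" by (auto simp: W_def)
    have Mg: "M g \<in> carrier_mat d d" unfolding d_def by (rule cg_module_carrier[OF mod g])
    have Vg: "dih_plane z g \<in> carrier_mat 2 2" using cg_module_carrier[OF V g] by simp
    have "M g *\<^sub>v x = (M g * P) *\<^sub>v x'" unfolding x(1) by (rule assoc_mult_mat_vec[symmetric, OF Mg P x(2)])
    also have "\<dots> = (P * dih_plane z g) *\<^sub>v x'" by (simp only: inter[OF g])
    also have "\<dots> = P *\<^sub>v (dih_plane z g *\<^sub>v x')" by (rule assoc_mult_mat_vec[OF P Vg x(2)])
    finally show "M g *\<^sub>v x \<in> W" unfolding W_def using Vg x(2) by auto
  qed
  moreover have "W \<noteq> {0\<^sub>v d}"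
  proof -
    have "P *\<^sub>v unit_vec 2 0 = v" using P v(1)
      by (intro eq_vecI) (auto simp: P_def scalar_prod_right_unit)
    hence "v \<in> W" unfolding W_def by (metis imageI unit_vec_carrier)
    thus ?thesis using v(2) by blast
  qed
  ultimately have "W = carrier_vec d" using M unfolding cg_simple_def d_def by blast
  then obtain Q where Q: "Q \<in> carrier_mat 2 d" "P * Q = 1\<^sub>m d"
    using surjective_imp_right_inverse[OF P] unfolding W_def by blast
  from right_inverse_imp_le[OF P Q] have "d \<le> 2" .
  with d0 consider "d = 1" | "d = 2" by linarith
  thus ?thesis
  proof cases
    assume d: "d = 2"
    have "cg_iso D (dih_plane z) M"
      by (rule cg_isoI[where P = P and Q = Q and d = 2]) (use P Q inter in \<open>simp_all add: d d_def[symmetric]\<close>)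
    thus thesis using that(2) zn by blast
  next
    assume d: "d = 1"
    define e where "e = B $$ (0, 0)"
    have B1: "B = mat 1 1 (\<lambda>_. e)" using B by (intro eq_matI) (auto simp: e_def d)
    have "(A *\<^sub>v v) $ 0 = A $$ (0, 0) * v $ 0" using A v(1) by (simp add: d scalar_prod_def)
    moreover have "i0 = 0" using i0(1) d by simp
    ultimately have "A $$ (0, 0) = z" using v(1,3) i0 d by simp
    hence A1: "A = mat 1 1 (\<lambda>_. z)" using A by (intro eq_matI) (auto simp: d)
    have ee: "e * e = 1" using arg_cong[OF AnB(2), of "\<lambda>X. X $$ (0, 0)"] by (simp add: B1 d scalar_prod_def)
    have "z * (e * z) = e" using arg_cong[OF AnB(3), of "\<lambda>X. X $$ (0, 0)"] by (simp add: B1 A1 scalar_prod_def)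
    hence "(z * z) * (e * e) = e * e" by (simp add: mult_ac)
    hence zz: "z * z = 1" by (simp add: ee)
    have X: "cg_module D (dih_char z e)" by (rule cg_module_dih_char[OF zn zz ee])
    have "cg_iso D (dih_char z e) M"
    proof (rule cg_isoI[where P = "1\<^sub>m 1" and Q = "1\<^sub>m 1" and d = 1])
      have rs: "1\<^sub>m 1 * dih_char z e rot = M rot * 1\<^sub>m 1" "1\<^sub>m 1 * dih_char z e refl = M refl * 1\<^sub>m 1"
        unfolding A_def[symmetric] B_def[symmetric]
        by (simp_all add: dih_char_rot[OF zn] dih_char_refl A1 B1 del: One_nat_def)
      have I: "1\<^sub>m 1 \<in> carrier_mat (cg_dim D M) (cg_dim D (dih_char z e))"
        using d by (simp add: d_def)
      show "1\<^sub>m 1 * dih_char z e g = M g * 1\<^sub>m 1" if "g \<in> carrier D" for g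
        by (rule intertwine_generators[OF X mod I rs that])
    qed (auto simp: d[unfolded d_def])
    thus thesis using that(1) zn zz ee by blast
  qed
qed

section \<open>Inverting a simple module\<close>

lemma sum_roots_reindex:
  assumes x: "x ^ n = 1"
  shows "(\<Sum>z | z ^ n = 1. f (x * z)) = (\<Sum>z | z ^ n = (1::complex). f z)"
  using root_nonzero[OF x] x
  by (intro sum.reindex_bij_witness[where i = "\<lambda>z. inverse x * z" and j = "\<lambda>z. x * z"])
    (auto simp: power_mult_distrib power_inverse)

lemma finite_roots: "finite {z::complex. z ^ n = 1}"
  using n_pos by (intro finite_roots_unity) auto

lemma rep_eq_tensor_transfer:
  assumes "cg_iso D X M" "cg_module D X" "cg_module D M" "cg_module D S"
  shows "rep_eq D (frag_of (cg_tensor M S)) (frag_of (cg_tensor X S))"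
  by (intro rep_eq_sym[OF rep_eq_iso] cg_iso_tensor cg_module_tensor assms)

text \<open>
  The regular module itself, written as a combination of simple modules, inverts a module of
  dimension one: multiplication by \<open>c\<close> only permutes the roots of unity. The planes with $z^2 = 1$
  are not simple and enter as sums of two lines.
\<close>

lemma knutson_index_iso_char:
  assumes c: "c ^ n = 1" "c * c = 1" "e * e = 1"
    and M: "cg_module D M" and iso: "cg_iso D (dih_char c e) M"
  shows "knutson_index D M = 1"
proof -
  define R1 where "R1 = {z::complex. z ^ n = 1 \<and> z * z = 1}"
  define R2 where "R2 = {z::complex. z ^ n = 1 \<and> z * z \<noteq> 1}"
  have fin: "finite R1" "finite R2" unfolding R1_def R2_def
    by (rule finite_subset[OF _ finite_roots], blast)+
  have R: "{z. z ^ n = 1} = R1 \<union> R2" "R1 \<inter> R2 = {}" by (auto simp: R1_def R2_def)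
  define N where "N = (\<Sum>z\<in>R1. frag_of (dih_char z 1) + frag_of (dih_char z (- 1))) + (\<Sum>z\<in>R2. frag_of (dih_plane z))"
  let ?F = "\<lambda>S. frag_of (cg_tensor M S)"
  have X: "cg_module D (dih_char c e)" by (rule cg_module_dih_char[OF c])
  show ?thesis
  proof (rule knutson_index_eq_1I)
    have simp1: "cg_simple D (dih_char z 1)" "cg_simple D (dih_char z (- 1))" if "z \<in> R1" for z
      using that by (auto simp: R1_def intro!: cg_simple_dih_char)
    have simp2: "cg_simple D (dih_plane z)" if "z \<in> R2" for z
      using that by (auto simp: R2_def intro!: cg_simple_dih_plane)
    have "N \<in> carrier (free_Abelian_group {S. cg_simple D S})"
      unfolding N_def
      by (intro add_closed_free_Abelian_group sum_closed_free_Abelian_group)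
        (auto simp: keys_frag_of simp1 simp2)
    thus "Poly_Mapping.keys N \<subseteq> {S. cg_simple D S}" by simp
    have "frag_extend ?F N = (\<Sum>z\<in>R1. ?F (dih_char z 1) + ?F (dih_char z (- 1))) + (\<Sum>z\<in>R2. ?F (dih_plane z))"
      using fin by (simp add: N_def frag_extend_add frag_extend_sum o_def)
    also have "rep_eq D \<dots> ((\<Sum>z\<in>R1. frag_of (dih_plane (c * z))) + (\<Sum>z\<in>R2. frag_of (dih_plane (c * z))))"
    proof (intro rep_eq_add rep_eq_sum)
      fix z assume "z \<in> R2"
      hence z: "z ^ n = 1" by (simp add: R2_def)
      have "rep_eq D (?F (dih_plane z)) (frag_of (cg_tensor (dih_char c e) (dih_plane z)))"
        by (rule rep_eq_tensor_transfer[OF iso X M cg_module_dih_plane[OF z]])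
      also have "rep_eq D \<dots> (frag_of (dih_plane (c * z)))"
        by (rule rep_eq_tensor_dih_char_dih_plane[OF c z])
      finally show "rep_eq D (?F (dih_plane z)) (frag_of (dih_plane (c * z)))" .
    next
      fix z assume "z \<in> R1"
      hence z: "z ^ n = 1" "z * z = 1" by (auto simp: R1_def)
      have cz: "(c * z) ^ n = 1" "(c * z) * (c * z) = 1"
        using z c by (auto simp: power_mult_distrib mult_ac)
      have "rep_eq D (?F (dih_char z s)) (frag_of (dih_char (c * z) (e * s)))" if "s * s = 1" for s
        using rep_eq_tensor_transfer[OF iso X M cg_module_dih_char[OF z that]]
        by (simp only: tensor_dih_char_dih_char)
      from this[of 1] this[of "-1"]
      have "rep_eq D (?F (dih_char z 1) + ?F (dih_char z (- 1))) (frag_of (dih_char (c * z) e) + frag_of (dih_char (c * z) (- e)))"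
        by (intro rep_eq_add) auto
      also have "rep_eq D \<dots> (frag_of (dih_plane (c * z)))"
        by (rule rep_eq_dih_char_pair[OF cz c(3)])
      finally show "rep_eq D (?F (dih_char z 1) + ?F (dih_char z (- 1))) (frag_of (dih_plane (c * z)))" .
    qed
    also have "(\<Sum>z\<in>R1. frag_of (dih_plane (c * z))) + (\<Sum>z\<in>R2. frag_of (dih_plane (c * z))) =
        (\<Sum>z | z ^ n = 1. frag_of (dih_plane (c * z)))"
      unfolding R(1) by (rule sum.union_disjoint[OF fin R(2), symmetric])
    also have "\<dots> = (\<Sum>z | z ^ n = 1. frag_of (dih_plane z))"
      by (rule sum_roots_reindex[OF c(1), where f = "\<lambda>z. frag_of (dih_plane z)"])
    also have "rep_eq D \<dots> (frag_of (regular_module D))" by (rule regular_decomposition)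
    finally show "rep_eq D (frag_extend ?F N) (frag_of (regular_module D))" .
  qed
qed

text \<open>
  For roots of unity $z^{-1}$ is the complex conjugate.
\<close>

lemma root_of_unity_Im:
  assumes z: "z ^ n = 1"
  shows "Im (inverse z) = - Im z" "z * z = 1 \<longleftrightarrow> Im z = 0"
proof -
  have nz: "norm z = 1" using z n_pos by (metis norm_one norm_power power_eq_1_iff norm_ge_zero not_one_le_zero)
  have "inverse z = cnj z"
    using nz complex_norm_square[of z] by (intro inverse_unique) simp
  thus im: "Im (inverse z) = - Im z" by simp
  show "z * z = 1 \<longleftrightarrow> Im z = 0"
  proof
    assume "z * z = 1"
    thus "Im z = 0" by (auto dest!: sign_cases)
  next
    assume "Im z = 0"
    hence "cnj z = z" by (simp add: complex_eq_iff)
    thus "z * z = 1" using nz complex_norm_square[of z] by simp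
  qed
qed

text \<open>
  The inverse is the permutation module on the cosets of the reflection, in its decomposition into
  simple modules: one line for each root of unity $z = \pm 1$, and one plane for each pair
  $z, z^{-1}$, represented by the root in the upper half plane. Tensoring a plane with a line
  contributes one plane and tensoring it with a plane contributes two, so each root of unity is met
  exactly once.
\<close>

lemma knutson_index_iso_plane:
  assumes x: "x ^ n = 1" and M: "cg_module D M" and iso: "cg_iso D (dih_plane x) M"
  shows "knutson_index D M = 1"
proof -
  define R where "R = {z::complex. z ^ n = 1}"
  define R0 where "R0 = {z \<in> R. Im z = 0}"
  define U where "U = {z \<in> R. Im z > 0}"
  define L where "L = {z \<in> R. Im z < 0}"
  have finR: "finite R" unfolding R_def by (rule finite_roots)
  hence fin: "finite R0" "finite U" "finite L" by (auto simp: R0_def U_def L_def)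
  have R: "R = R0 \<union> (U \<union> L)" "R0 \<inter> (U \<union> L) = {}" "U \<inter> L = {}"
    by (auto simp: R0_def U_def L_def)
  define N where "N = (\<Sum>z\<in>R0. frag_of (dih_char z 1)) + (\<Sum>z\<in>U. frag_of (dih_plane z))"
  let ?F = "\<lambda>S. frag_of (cg_tensor M S)"
  let ?V = "\<lambda>z. frag_of (dih_plane z)"
  have X: "cg_module D (dih_plane x)" by (rule cg_module_dih_plane[OF x])
  have rootR0: "z ^ n = 1" "z * z = 1" if "z \<in> R0" for z
    using that root_of_unity_Im(2)[of z] by (auto simp: R0_def R_def)
  have rootU: "z ^ n = 1" "z * z \<noteq> 1" if "z \<in> U" for z
    using that root_of_unity_Im(2)[of z] by (auto simp: U_def R_def)
  show ?thesis
  proof (rule knutson_index_eq_1I)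
    have "cg_simple D (dih_char z 1)" if "z \<in> R0" for z
      using rootR0[OF that] by (intro cg_simple_dih_char) auto
    moreover have "cg_simple D (dih_plane z)" if "z \<in> U" for z
      using rootU[OF that] by (rule cg_simple_dih_plane)
    ultimately have "N \<in> carrier (free_Abelian_group {S. cg_simple D S})"
      unfolding N_def
      by (intro add_closed_free_Abelian_group sum_closed_free_Abelian_group) (auto simp: keys_frag_of)
    thus "Poly_Mapping.keys N \<subseteq> {S. cg_simple D S}" by simp
    have "frag_extend ?F N = (\<Sum>z\<in>R0. ?F (dih_char z 1)) + (\<Sum>z\<in>U. ?F (dih_plane z))"
      using fin by (simp add: N_def frag_extend_add frag_extend_sum o_def)
    also have "rep_eq D \<dots> ((\<Sum>z\<in>R0. ?V (x * z)) + (\<Sum>z\<in>U. ?V (x * z) + ?V (x * inverse z)))"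
    proof (intro rep_eq_add rep_eq_sum)
      fix z assume "z \<in> R0"
      note z = rootR0[OF this]
      have "rep_eq D (?F (dih_char z 1)) (frag_of (cg_tensor (dih_plane x) (dih_char z 1)))"
        by (rule rep_eq_tensor_transfer[OF iso X M cg_module_dih_char[OF z]]) simp
      also have "rep_eq D \<dots> (?V (x * z))"
        by (rule rep_eq_tensor_dih_plane_dih_char[OF x z])
      finally show "rep_eq D (?F (dih_char z 1)) (?V (x * z))" .
    next
      fix z assume "z \<in> U"
      note z = rootU(1)[OF this]
      have "rep_eq D (?F (dih_plane z)) (frag_of (cg_tensor (dih_plane x) (dih_plane z)))"
        by (rule rep_eq_tensor_transfer[OF iso X M cg_module_dih_plane[OF z]])
      also have "rep_eq D \<dots> (?V (x * z) + ?V (x * inverse z))"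
        by (rule rep_eq_tensor_dih_plane_dih_plane[OF x z])
      finally show "rep_eq D (?F (dih_plane z)) (?V (x * z) + ?V (x * inverse z))" .
    qed
    also have "(\<Sum>z\<in>U. ?V (x * z) + ?V (x * inverse z)) = (\<Sum>z\<in>U. ?V (x * z)) + (\<Sum>z\<in>U. ?V (x * inverse z))"
      by (rule sum.distrib)
    also have "(\<Sum>z\<in>U. ?V (x * inverse z)) = (\<Sum>z\<in>L. ?V (x * z))"
      by (rule sum.reindex_bij_witness[where i = inverse and j = inverse])
        (auto simp: U_def L_def R_def root_of_unity_Im(1) power_inverse simp del: inverse_complex.sel)
    also have "(\<Sum>z\<in>R0. ?V (x * z)) + ((\<Sum>z\<in>U. ?V (x * z)) + (\<Sum>z\<in>L. ?V (x * z))) = (\<Sum>z\<in>R. ?V (x * z))"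
      unfolding R(1) using fin R(2,3) by (simp add: sum.union_disjoint)
    also have "\<dots> = (\<Sum>z | z ^ n = 1. ?V z)"
      unfolding R_def by (rule sum_roots_reindex[OF x, where f = ?V])
    also have "rep_eq D \<dots> (frag_of (regular_module D))" by (rule regular_decomposition)
    finally show "rep_eq D (frag_extend ?F N) (frag_of (regular_module D))" .
  qed
qed

lemma knutson_type_dihedral: "knutson_type D"
  unfolding knutson_type_def
proof (intro allI impI)
  fix M assume M: "cg_simple D M"
  hence mod: "cg_module D M" by (simp add: cg_simple_def)
  from M show "knutson_index D M = 1"
    by (cases rule: simple_module_cases) (use mod knutson_index_iso_char knutson_index_iso_plane in blast)+
qed

end

theorem mainTheorem8:
  fixes n :: nat
  assumes "n \<ge> 1"
  shows "knutson_type (dihedral_group n)"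
  using assms by (rule knutson_type_dihedral)

end
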